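(* Let $\lambda > 0$ and let $D \subset \mathbb{R}^3$ be a bounded domain (connected open set) whose complement $\mathbb{R}^3 \setminus D$ is connected. Let $r > 0$ be such that $|B_r| = |D|$, where $|\cdot|$ denotes Lebesgue measure (volume) and $B_r$ is an open ball of radius $r$. Define the complex-valued functions $$E_\lambda^{\pm}(x,y) = \frac{\exp\{\pm \mathrm{i}\lambda|x-y|\}}{|x-y|}, \qquad x \neq y,$$ and $$a_3^-(t) = \Gamma\!\left(\tfrac{5}{2}\right)\frac{J_{3/2}(t)}{(t/2)^{3/2}},$$ where $J_{3/2}$ is the Bessel function of order $3/2$. Suppose that for some $x_0 \in D$ we have $D \subset B_{r_0}(x_0)$, where $r_0 > 0$ is defined by $\lambda r_0 = j_{3/2,1}$, the first positive zero of $J_{3/2}$, and that the identities $$a_3^-(\lambda r)\, E_\lambda^{+}(x, x_0) = \frac{1}{|D|}\int_D E_\lambda^{+}(y, x)\, \mathrm{d}y \quad\text{and}\quad a_3^-(\lambda r)\, E_\lambda^{-}(x, x_0) = \frac{1}{|D|}\int_D E_\lambda^{-}(y, x)\, \mathrm{d}y$$ both hold for every $x \in \mathbb{R}^3 \setminus D$. Then $D = B_r(x_0)$, the open ball of radius $r$ centred at $x_0$.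
   Context: $E_\lambda^{\pm}$ are the two fundamental solutions of the Helmholtz equation $\nabla^2 u + \lambda^2 u = 0$ in $\mathbb{R}^3$. $B_\rho(x) = \{y \in \mathbb{R}^3 : |y-x| < \rho\}$. *)

theory Defs
  imports "HOL-Analysis.Analysis"
begin

text \<open>Bessel function of the first kind of real order nu, via its defining power series
  (used for t > 0).\<close>
definition bessel_J :: "real \<Rightarrow> real \<Rightarrow> real" where
  "bessel_J nu t = (\<Sum>m. (-1) ^ m / (fact m * Gamma (real m + nu + 1)) * (t / 2) powr (2 * real m + nu))"

definition a3_minus :: "real \<Rightarrow> real" where
  "a3_minus t = Gamma (5 / 2) * bessel_J (3 / 2) t / (t / 2) powr (3 / 2)"

text \<open>The two fundamental solutions of the Helmholtz equation in R^3.\<close>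
definition E_plus :: "real \<Rightarrow> real^3 \<Rightarrow> real^3 \<Rightarrow> complex" where
  "E_plus lam x y = exp (\<i> * complex_of_real (lam * dist x y)) / complex_of_real (dist x y)"

definition E_minus :: "real \<Rightarrow> real^3 \<Rightarrow> real^3 \<Rightarrow> complex" where
  "E_minus lam x y = exp (- \<i> * complex_of_real (lam * dist x y)) / complex_of_real (dist x y)"

end

theory Submission
  imports Defs "HOL-Complex_Analysis.Complex_Analysis"
begin

text \<open>
  Real and imaginary parts of the identity for \<open>E\<^sup>+\<close> give identities for the kernels
  \<open>cos (\<lambda>|x - y|) / |x - y|\<close> and \<open>sin (\<lambda>|x - y|) / |x - y|\<close>.
  The sine kernel is entire in \<open>|x - y|\<^sup>2\<close>, so along a line through \<open>x\<^sub>0\<close> its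
  identity continues analytically from the exterior of \<open>D\<close> to \<open>x = x\<^sub>0\<close>. There
  it says that \<open>sin (\<lambda>|y - x\<^sub>0|) / |y - x\<^sub>0|\<close> has the same integral over \<open>D\<close>
  as over \<open>B\<^sub>r(x\<^sub>0)\<close>. This function is radially strictly decreasing on
  \<open>B\<^sub>r\<^sub>0(x\<^sub>0)\<close>, because \<open>J\<^sub>3\<^sub>/\<^sub>2(t)\<close> is a positive multiple of
  \<open>sin t - t cos t\<close>, and the two sets have equal volume; hence \<open>D \<subseteq> B\<^sub>r(x\<^sub>0)\<close> and
  the difference is a null set. At a point of \<open>B\<^sub>r(x\<^sub>0) - D\<close> the cosine identity would
  then hold with \<open>B\<^sub>r(x\<^sub>0)\<close> in place of \<open>D\<close>, which the explicit value of that
  integral excludes.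
\<close>

subsection \<open>The Bessel function of order 3/2\<close>

text \<open>Once the first terms of the sine and cosine series are split off, the two linear terms
  cancel, and \<open>1 / (2m+2)! - 1 / (2m+3)! = (2m+2) / (2m+3)!\<close>. The series thus starts at
  the third power, as needed for comparison with the Bessel series.\<close>

lemma sin_minus_mult_cos_sums:
  fixes t :: real
  shows "(\<lambda>m. (-1) ^ m * (2 * real m + 2) / fact (2 * m + 3) * t ^ (2 * m + 3)) sums (sin t - t * cos t)"
proof -
  have s: "(\<lambda>n. (-1) ^ Suc n / fact (2 * Suc n + 1) * t ^ (2 * Suc n + 1)) sums (sin t - t)"
    using sums_Suc_iff[of "\<lambda>n. (-1) ^ n / fact (2 * n + 1) * t ^ (2 * n + 1)" "sin t - t"] sin_paired[of t] by simp
  have "(\<lambda>n. (-1) ^ Suc n / fact (2 * Suc n) * t ^ (2 * Suc n)) sums (cos t - 1)"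
    using sums_Suc_iff[of "\<lambda>n. (-1) ^ n / fact (2 * n) * t ^ (2 * n)" "cos t - 1"] cos_paired[of t] by simp
  note sums_diff[OF s sums_mult[OF this, of t]]
  moreover have "(-1) ^ Suc n / fact (2 * Suc n + 1) * t ^ (2 * Suc n + 1)
      - t * ((-1) ^ Suc n / fact (2 * Suc n) * t ^ (2 * Suc n))
    = (-1) ^ n * (2 * real n + 2) / fact (2 * n + 3) * t ^ (2 * n + 3)" for n
  proof -
    have f: "fact (2 * n + 3) = (2 * real n + 3) * fact (2 * n + 2)"
      by (simp add: eval_nat_numeral algebra_simps)
    have e: "2 * Suc n = 2 * n + 2" "2 * n + 2 + 1 = 2 * n + 3" by auto
    have p: "t ^ (2 * n + 3) = t * t ^ (2 * n + 2)" by (simp add: eval_nat_numeral)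
    have "x / ((2 * real n + 3) * F) * (t * w) - t * (x / F * w) = - x * (2 * real n + 2) / ((2 * real n + 3) * F) * (t * w)"
      if "F > 0" for x F w :: real
    proof -
      have "2 * real n + 3 > 0" by simp
      then show ?thesis using that by (simp add: divide_simps) (simp add: algebra_simps)
    qed
    from this[of "fact (2 * n + 2)" "(-1) ^ Suc n" "t ^ (2 * n + 2)"]
    show ?thesis unfolding e f p by (simp del: fact_Suc power_Suc add: power_Suc[of "-1"])
  qed
  ultimately show ?thesis by (simp add: algebra_simps)
qed

text \<open>Passing from m to m + 1 divides both sides by
  \<open>4 (m+1) (m + 5/2) = (2m+2) (2m+5)\<close>, which gives the induction. The identity matches
  the normalised Bessel coefficients with those of sin t - t cos t.\<close>

lemma Gamma_coeff_three_halves: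
  "Gamma (5 / 2) / (fact m * Gamma (real m + 5 / 2) * 4 ^ m) = 3 * (2 * real m + 2) / fact (2 * m + 3)"
proof (induction m)
  case 0
  have "Gamma (5/2 :: real) \<noteq> 0" using Gamma_real_pos[of "5/2"] by linarith
  then show ?case by (simp add: fact_numeral)
next
  case (Suc m)
  have g: "Gamma (real (Suc m) + 5 / 2) = (real m + 5/2) * Gamma (real m + 5 / 2)"
    using Gamma_plus1[of "real m + 5/2"] by (simp add: add_ac nonpos_Ints_def)
  have f: "fact (2 * Suc m + 3) = (2 * real m + 5) * (2 * real m + 4) * fact (2 * m + 3)"
    by (simp add: eval_nat_numeral algebra_simps)
  have pos: "Gamma (real m + 5/2) > 0" "(fact (2*m+3)::real) > 0" "(fact m::real) > 0"
    by (auto intro!: Gamma_real_pos)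
  have "Gamma (5 / 2) / (fact (Suc m) * Gamma (real (Suc m) + 5 / 2) * 4 ^ Suc m)
     = Gamma (5 / 2) / (fact m * Gamma (real m + 5 / 2) * 4 ^ m) / (4 * (real m + 1) * (real m + 5/2))"
    unfolding g by (simp add: mult_ac)
  also have "\<dots> = 3 * (2 * real (Suc m) + 2) / fact (2 * Suc m + 3)"
    unfolding Suc f
  proof -
    have "3 * (2 * real m + 2) / F / (4 * (real m + 1) * (real m + 5 / 2)) =
      3 * (2 * real (Suc m) + 2) / ((2 * real m + 5) * (2 * real m + 4) * F)" if "F > 0" for F :: real
    proof -
      have "2 * real m + 5 > 0" "2 * real m + 4 > 0" "real m + 1 > 0" "real m + 5/2 > 0" by auto
      then show ?thesis using that by (simp add: divide_simps) (simp add: algebra_simps)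
    qed
    then show "3 * (2 * real m + 2) / fact (2 * m + 3) / (4 * (real m + 1) * (real m + 5 / 2)) =
      3 * (2 * real (Suc m) + 2) / ((2 * real m + 5) * (2 * real m + 4) * fact (2 * m + 3))"
      using pos(2) by blast
  qed
  finally show ?case .
qed

text \<open>Term-by-term comparison of the two power series. The power of t/2 and the Gamma factor
  are kept in front because exactly these cancel in \<open>a3_minus\<close>.\<close>

lemma bessel_J_three_halves:
  assumes "t > 0"
  shows "bessel_J (3 / 2) t = (t / 2) powr (3 / 2) / Gamma (5 / 2) * (3 * (sin t - t * cos t) / t ^ 3)"
proof -
  let ?C = "(t / 2) powr (3 / 2) / Gamma (5 / 2) * 3 / t ^ 3"
  have G: "Gamma (5/2 :: real) \<noteq> 0" using Gamma_real_pos[of "5/2"] by linarith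
  have "(-1) ^ m / (fact m * Gamma (real m + 3 / 2 + 1)) * (t / 2) powr (2 * real m + 3 / 2)
     = ?C * ((-1) ^ m * (2 * real m + 2) / fact (2 * m + 3) * t ^ (2 * m + 3))" for m
  proof -
    have p: "(t / 2) powr (2 * real m + 3 / 2) = t ^ (2 * m) / 4 ^ m * (t/2) powr (3/2)"
    proof -
      have "(t / 2) powr (2 * real m) = (t/2) ^ (2*m)"
        using assms powr_realpow[of "t/2" "2*m"] by simp
      then show ?thesis by (simp add: powr_add power_divide power_mult)
    qed
    have q: "t ^ (2 * m + 3) = t ^ (2*m) * t ^ 3" by (rule power_add)
    have g: "real m + 3 / 2 + 1 = real m + 5/2" by simp
    have "(-1) ^ m / (fact m * Gamma (real m + 5/2)) * (t ^ (2 * m) / 4 ^ m * (t/2) powr (3/2))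
      = (-1) ^ m * t ^ (2 * m) * (t/2) powr (3/2) / Gamma (5/2) * (Gamma (5 / 2) / (fact m * Gamma (real m + 5 / 2) * 4 ^ m))"
      using G by simp
    also have "\<dots> = ?C * ((-1) ^ m * (2 * real m + 2) / fact (2 * m + 3) * (t ^ (2*m) * t ^ 3))"
      unfolding Gamma_coeff_three_halves using assms by (simp add: mult_ac del: fact_Suc)
    finally show ?thesis unfolding p q g .
  qed
  moreover note sums_mult[OF sin_minus_mult_cos_sums[of t], of ?C]
  ultimately have "bessel_J (3 / 2) t = ?C * (sin t - t * cos t)"
    unfolding bessel_J_def by (simp add: sums_iff)
  then show ?thesis by simp
qed

lemma bessel_J_three_halves_eq_0_iff:
  assumes "t > 0"
  shows "bessel_J (3 / 2) t = 0 \<longleftrightarrow> sin t - t * cos t = 0"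
proof -
  have "Gamma (5/2 :: real) \<noteq> 0" using Gamma_real_pos[of "5/2"] by linarith
  then show ?thesis using assms by (simp add: bessel_J_three_halves)
qed

lemma a3_minus_eq:
  assumes "t > 0"
  shows "a3_minus t = 3 * (sin t - t * cos t) / t ^ 3"
proof -
  have "Gamma (5/2 :: real) \<noteq> 0" using Gamma_real_pos[of "5/2"] by linarith
  then show ?thesis using assms unfolding a3_minus_def by (simp add: bessel_J_three_halves)
qed

text \<open>The derivative t sin t is positive on (0, pi), so the function leaves 0 upwards. A
  negative value before T would force a zero by the intermediate value theorem.\<close>

lemma sin_minus_mult_cos_pos:
  fixes t T :: real
  assumes nz: "\<And>t. 0 < t \<Longrightarrow> t < T \<Longrightarrow> sin t - t * cos t \<noteq> 0" and t: "0 < t" "t < T"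
  shows "sin t - t * cos t > 0"
proof (rule ccontr)
  let ?f = "\<lambda>t::real. sin t - t * cos t"
  assume "\<not> ?thesis"
  then have neg: "?f t < 0" using nz[OF t] by linarith
  \<comment> \<open>This point lies below pi, where positivity follows from the derivative, and is
    at most t, so that it can start the interval for the intermediate value theorem.\<close>
  define s where "s = min t 1"
  have s: "0 < s" "s \<le> t" "s < pi" using t pi_gt3 by (auto simp: s_def)
  have "?f 0 < ?f s"
  proof (rule DERIV_pos_imp_increasing_open[OF s(1)])
    fix x assume x: "0 < x" "x < s"
    have "(?f has_real_derivative x * sin x) (at x)"
      by (auto intro!: derivative_eq_intros)
    moreover have "x * sin x > 0" using x s by (simp add: sin_gt_zero)
    ultimately show "\<exists>y. (?f has_real_derivative y) (at x) \<and> 0 < y" by blast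
  qed (auto intro!: continuous_intros)
  then have "?f s > 0" by simp
  moreover have "continuous_on {s..t} ?f" by (intro continuous_intros)
  ultimately obtain x where "s \<le> x" "x \<le> t" "?f x = 0"
    using IVT2'[of ?f t 0 s] neg s by auto
  then show False using nz[of x] s t by auto
qed

text \<open>The derivative is -(sin(lam x) - lam x cos(lam x)) / x^2. Its sign is needed only on the
  open interval, so t may equal T, where lam T may be a zero. The case s = 0 is excluded because
  there the quotient has the value 0 by the convention for division instead of its limit.\<close>

lemma sinc_strict_decreasing:
  fixes lam T s t :: real
  assumes lam: "lam > 0" and nz: "\<And>t. 0 < t \<Longrightarrow> t < lam * T \<Longrightarrow> sin t - t * cos t \<noteq> 0"
    and st: "0 < s" "s < t" "t \<le> T"
  shows "sin (lam * t) / t < sin (lam * s) / s"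
proof (rule DERIV_neg_imp_decreasing_open[OF st(2)])
  fix x assume x: "s < x" "x < t"
  have "((\<lambda>x. sin (lam * x) / x) has_real_derivative (cos (lam * x) * lam * x - sin (lam * x)) / x\<^sup>2) (at x)"
    using x st by (auto intro!: derivative_eq_intros simp: power2_eq_square)
  moreover have "sin (lam * x) - (lam * x) * cos (lam * x) > 0"
    using lam x st by (intro sin_minus_mult_cos_pos[OF nz]) auto
  then have "(cos (lam * x) * lam * x - sin (lam * x)) / x\<^sup>2 < 0"
    using x st by (auto simp: divide_less_0_iff mult_ac)
  ultimately show "\<exists>y. ((\<lambda>x. sin (lam * x) / x) has_real_derivative y) (at x) \<and> y < 0" by blast
qed (use st in \<open>auto intro!: continuous_intros\<close>)

subsection \<open>Integration in cylindrical coordinates\<close>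

text \<open>The points of the plane with sum of squares below c form a disc of area pi c. Hence the
  squared radius has constant density pi on the half-line, which replaces polar coordinates.\<close>

lemma distr_lborel_sum_squares:
  "distr lborel borel (\<lambda>p::real \<times> real. (fst p)\<^sup>2 + (snd p)\<^sup>2)
    = density lborel (\<lambda>q. ennreal (pi * indicator {0..} q))" (is "?M = _")
proof -
  \<comment> \<open>The criterion \<open>measure_eqI_lessThan\<close> needs finite measures of upper
    rays. For the squared radius these are infinite, so its negative is treated first and the sign
    is reversed afterwards.\<close>
  let ?P = "distr lborel borel (\<lambda>p::real \<times> real. - ((fst p)\<^sup>2 + (snd p)\<^sup>2))"
  let ?N = "density lborel (\<lambda>q::real. ennreal (pi * indicator {..0} q))"
  have [measurable]: "(\<lambda>p::real \<times> real. (fst p)\<^sup>2 + (snd p)\<^sup>2) \<in> borel_measurable borel"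
    by (intro borel_measurable_continuous_onI continuous_intros)
  have [measurable]: "(\<lambda>p::real \<times> real. - ((fst p)\<^sup>2 + (snd p)\<^sup>2)) \<in> borel_measurable borel"
    "(\<lambda>p::real \<times> real. - (fst p)\<^sup>2 - (snd p)\<^sup>2) \<in> borel_measurable borel"
    by (intro borel_measurable_continuous_onI continuous_intros)+
  have P: "emeasure ?P {x<..} = ennreal (pi * max 0 (- x))" for x
  proof -
    have *: "emeasure ?P {x<..} = emeasure lborel {p::real \<times> real. (fst p)\<^sup>2 + (snd p)\<^sup>2 < - x}"
      by (subst emeasure_distr) (auto intro!: arg_cong[where f="emeasure lborel"])
    show ?thesis
    proof (cases "x < 0")
      case True
      have "{p::real \<times> real. (fst p)\<^sup>2 + (snd p)\<^sup>2 < - x} = ball 0 (sqrt (- x))"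
        by (auto simp: dist_norm norm_prod_def)
      then show ?thesis unfolding * using True
        by (simp add: emeasure_ball unit_ball_vol_2)
    next
      case False
      have "{p::real \<times> real. (fst p)\<^sup>2 + (snd p)\<^sup>2 < - x} = {}"
        using False sum_power2_ge_zero by (auto simp: not_less) (smt (verit) zero_le_power2)
      then show ?thesis unfolding * using False by (auto simp: max_def)
    qed
  qed
  have N: "emeasure ?N {x<..} = ennreal (pi * max 0 (- x))" for x
  proof -
    have "emeasure ?N {x<..} = (\<integral>\<^sup>+ q. ennreal pi * indicator {x<..0} q \<partial>lborel)"
      by (subst emeasure_density) (auto intro!: nn_integral_cong split: split_indicator)
    also have "\<dots> = ennreal pi * emeasure lborel {x<..0}"
      by (rule nn_integral_cmult_indicator) auto
    also have "\<dots> = ennreal (pi * max 0 (- x))"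
      by (cases "x \<le> 0") (auto simp: ennreal_mult[symmetric] max_def)
    finally show ?thesis .
  qed
  have "?P = ?N" by (rule measure_eqI_lessThan) (auto simp only: P N sets_distr sets_density sets_lborel ennreal_less_top infinity_ennreal_def)
  then have "distr ?P borel uminus = distr ?N borel uminus" by simp
  moreover have "distr ?P borel uminus = ?M"
    by (subst distr_distr) (auto simp: o_def add.commute)
  moreover have "distr ?N borel uminus = density (distr lborel borel uminus) (\<lambda>q::real. ennreal (pi * indicator {0..} q))"
    by (subst density_distr) (auto simp: indicator_def cong: if_cong)
  ultimately show ?thesis by (simp add: lborel_distr_uminus)
qed

text \<open>Boxes correspond to boxes with the same side lengths. This carries integrals over
  \<open>real^3\<close> to an iterated product, where product measures are available.\<close>

lemma distr_lborel_vec3: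
  "distr lborel borel (\<lambda>z::real^3. (z $ 1, z $ 2, z $ 3)) = lborel"
proof (rule lborel_eqI[symmetric])
  fix l u :: "real \<times> real \<times> real"
  assume le: "\<And>b. b \<in> Basis \<Longrightarrow> l \<bullet> b \<le> u \<bullet> b"
  obtain l1 l2 l3 u1 u2 u3 where lu: "l = (l1, l2, l3)" "u = (u1, u2, u3)" by (metis prod_cases3)
  have le': "l1 \<le> u1" "l2 \<le> u2" "l3 \<le> u3"
    using le[of "(1,0,0)"] le[of "(0,1,0)"] le[of "(0,0,1)"] by (auto simp: lu Basis_prod_def zero_prod_def)
  have [measurable]: "(\<lambda>z::real^3. (z $ 1, z $ 2, z $ 3)) \<in> borel_measurable borel"
    by (intro borel_measurable_continuous_onI continuous_intros)
  have "(\<lambda>z::real^3. (z $ 1, z $ 2, z $ 3)) -` box l u = box (vector [l1, l2, l3]) (vector [u1, u2, u3])"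
    unfolding lu by (simp add: set_eq_iff mem_box_cart forall_3 vector_3 box_prod)
  then have "emeasure (distr lborel borel (\<lambda>z::real^3. (z $ 1, z $ 2, z $ 3))) (box l u)
      = emeasure lborel (box (vector [l1, l2, l3] :: real^3) (vector [u1, u2, u3]))"
    by (subst emeasure_distr) auto
  also have "\<dots> = ennreal ((u1 - l1) * (u2 - l2) * (u3 - l3))"
  proof -
    have B: "(Basis :: (real^3) set) = {axis 1 1, axis 2 1, axis 3 1}"
      unfolding Basis_vec_def by (simp add: UNIV_3 insert_commute)
    have "axis 1 1 \<noteq> (axis 2 1 :: real^3)" "axis 1 1 \<noteq> (axis 3 1 :: real^3)" "axis 2 1 \<noteq> (axis 3 1 :: real^3)"
      by (auto simp: axis_eq_axis)
    then show ?thesis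
      by (subst emeasure_lborel_box) (auto simp: B inner_axis vector_3 le' mult_ac)
  qed
  also have "\<dots> = ennreal (\<Prod>b\<in>Basis. (u - l) \<bullet> b)"
    proof -
    have B: "(Basis :: (real\<times>real\<times>real) set) = {(1, 0, 0), (0, 1, 0), (0, 0, 1)}"
      by (auto simp: Basis_prod_def zero_prod_def)
    show ?thesis by (simp add: lu B mult_ac)
  qed
  finally show "emeasure (distr lborel borel (\<lambda>z::real^3. (z $ 1, z $ 2, z $ 3))) (box l u)
      = ennreal (\<Prod>b\<in>Basis. (u - l) \<bullet> b)" .
qed auto

text \<open>Cylindrical coordinates with the angle integrated out: the position along the first axis
  is kept, and the two transversal coordinates enter only through the squared distance q from that
  axis.\<close>

lemma distr_lborel_cylindrical:
  "distr lborel borel (\<lambda>z::real^3. (z $ 1, (z $ 2)\<^sup>2 + (z $ 3)\<^sup>2))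
    = lborel \<Otimes>\<^sub>M density lborel (\<lambda>q. ennreal (pi * indicator {0..} q))"
proof -
  let ?Q = "density lborel (\<lambda>q::real. ennreal (pi * indicator {0..} q))"
  let ?h = "\<lambda>p::real \<times> real. (fst p)\<^sup>2 + (snd p)\<^sup>2"
  have [measurable]: "(\<lambda>z::real^3. (z $ 1, z $ 2, z $ 3)) \<in> borel_measurable borel"
     "?h \<in> borel_measurable borel"
    by (intro borel_measurable_continuous_onI continuous_intros)+
  have [measurable]: "(\<lambda>p::real\<times>real\<times>real. (fst p, ?h (snd p))) \<in> borel_measurable borel"
    by (intro borel_measurable_continuous_onI continuous_intros)+
  have "sigma_finite_measure ?Q"
    by (subst sigma_finite_measure.sigma_finite_iff_density_finite[OF sigma_finite_lborel]) auto
  then have sf: "sigma_finite_measure (distr lborel borel ?h)"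
    by (simp add: distr_lborel_sum_squares)
  have "lborel \<Otimes>\<^sub>M ?Q = distr lborel borel (\<lambda>x::real. x) \<Otimes>\<^sub>M distr lborel borel ?h"
    by (simp add: distr_lborel_sum_squares distr_id2)
  also have "\<dots> = distr (lborel \<Otimes>\<^sub>M lborel) (borel \<Otimes>\<^sub>M borel) (\<lambda>(x, y). (x, ?h y))"
    by (rule pair_measure_distr[OF _ _ sf]) auto
  also have "\<dots> = distr lborel borel (\<lambda>p::real\<times>real\<times>real. (fst p, ?h (snd p)))"
    by (simp add: lborel_prod borel_prod case_prod_beta')
  also have "\<dots> = distr (distr lborel borel (\<lambda>z::real^3. (z $ 1, z $ 2, z $ 3))) borel (\<lambda>p. (fst p, ?h (snd p)))"
    by (simp add: distr_lborel_vec3)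
  also have "\<dots> = distr lborel borel (\<lambda>z::real^3. (z $ 1, (z $ 2)\<^sup>2 + (z $ 3)\<^sup>2))"
    by (subst distr_distr) (auto simp: o_def)
  finally show ?thesis by simp
qed

text \<open>The preimage of a box is its image under the inverse map, which is again orthogonal and
  so preserves volume.\<close>

lemma distr_lborel_orthogonal:
  fixes f :: "real^3 \<Rightarrow> real^3"
  assumes "orthogonal_transformation f"
  shows "distr lborel borel f = lborel"
proof (rule lborel_eqI[symmetric])
  fix l u :: "real^3"
  assume le: "\<And>b. b \<in> Basis \<Longrightarrow> l \<bullet> b \<le> u \<bullet> b"
  have lin: "linear f" using assms by (rule orthogonal_transformation_linear)
  have [measurable]: "f \<in> borel_measurable borel"
    using lin by (intro borel_measurable_continuous_onI) (simp add: linear_continuous_on linear_conv_bounded_linear)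
  have g: "orthogonal_transformation (inv f)" using assms by (rule orthogonal_transformation_inv)
  have bij: "bij f" using assms by (rule orthogonal_transformation_bij)
  have [measurable]: "f -` box l u \<in> sets borel"
    using measurable_sets[of f borel borel "box l u"] by simp
  have im: "f -` box l u = inv f ` box l u" using bij by (simp add: bij_vimage_eq_inv_image)
  have "inv f ` box l u \<in> lmeasurable" by (rule measurable_orthogonal_image[OF g]) simp
  then have fin: "emeasure lborel (f -` box l u) \<noteq> \<infinity>"
    unfolding im[symmetric] fmeasurable_def by (auto simp: less_top)
  have "emeasure (distr lborel borel f) (box l u) = emeasure lborel (f -` box l u)"
    by (subst emeasure_distr) auto
  also have "\<dots> = ennreal (measure lborel (f -` box l u))"
    using fin by (intro emeasure_eq_ennreal_measure) auto
  also have "measure lborel (f -` box l u) = measure lebesgue (inv f ` box l u)"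
    unfolding im[symmetric] by (simp add: measure_completion)
  also have "\<dots> = measure lebesgue (box l u)"
    by (rule measure_orthogonal_image[OF g]) simp
  also have "\<dots> = (\<Prod>b\<in>Basis. (u - l) \<bullet> b)"
    using le by (simp add: measure_completion)
  finally show "emeasure (distr lborel borel f) (box l u) = ennreal (\<Prod>b\<in>Basis. (u - l) \<bullet> b)" .
qed auto

subsection \<open>Helmholtz potentials of a ball\<close>

text \<open>The observation point is the origin and the ball has its centre at -\<rho> on the first
  axis. In the plane at position u, the q-derivative of
  \<open>2 * \<Phi> (sqrt (u\<^sup>2 + q))\<close> is the kernel, so the slice integrates exactly.
  The condition u \<noteq> 0 keeps the slice away from the singularity. Leaving \<phi> and \<Phi>
  abstract covers sine and cosine at once.\<close>

lemma kernel_integral_inner: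
  fixes \<phi> \<Phi> :: "real \<Rightarrow> real" and \<rho> r u :: real
  defines "g \<equiv> \<lambda>u q. if 0 \<le> q \<and> (u + \<rho>)\<^sup>2 + q \<le> r\<^sup>2 then \<phi> (sqrt (u\<^sup>2 + q)) / sqrt (u\<^sup>2 + q) else 0"
  assumes deriv: "\<And>t. (\<Phi> has_real_derivative \<phi> t) (at t)" and cont: "continuous_on UNIV \<phi>"
    and "r > 0" "u \<noteq> 0"
  shows "has_bochner_integral (density lborel (\<lambda>q. ennreal (pi * indicator {0..} q))) (g u)
    (indicator {-\<rho>-r..r-\<rho>} u * (2 * pi * (\<Phi> (sqrt (r\<^sup>2 - \<rho>\<^sup>2 - 2 * u * \<rho>)) - \<Phi> \<bar>u\<bar>)))"
proof -
  have [measurable]: "\<phi> \<in> borel_measurable borel" using cont by (rule borel_measurable_continuous_onI)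
  \<comment> \<open>The squared radius of the disc that the plane cuts from the closed ball; it is
    negative when the plane misses the ball.\<close>
  define R where "R = r\<^sup>2 - (u + \<rho>)\<^sup>2"
  have mem: "u \<in> {-\<rho>-r..r-\<rho>} \<longleftrightarrow> 0 \<le> R"
    using abs_le_square_iff[of "u + \<rho>" r] \<open>r > 0\<close> by (auto simp: R_def)
  have "has_bochner_integral lborel (\<lambda>q. (pi * indicator {0..} q) *\<^sub>R g u q)
     (indicator {-\<rho>-r..r-\<rho>} u * (2 * pi * (\<Phi> (sqrt (r\<^sup>2 - \<rho>\<^sup>2 - 2 * u * \<rho>)) - \<Phi> \<bar>u\<bar>)))"
  proof (cases "0 \<le> R")
    case True
    have pos: "u\<^sup>2 + q > 0" if "q \<ge> 0" for q using \<open>u \<noteq> 0\<close> that by (simp add: add_pos_nonneg)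
    have "has_bochner_integral lborel (\<lambda>q. indicator {0..R} q *\<^sub>R (pi * (\<phi> (sqrt (u\<^sup>2 + q)) / sqrt (u\<^sup>2 + q))))
       (2 * pi * \<Phi> (sqrt (u\<^sup>2 + R)) - 2 * pi * \<Phi> (sqrt (u\<^sup>2 + 0)))"
    proof (rule has_bochner_integral_FTC_Icc[OF True])
      fix q assume q: "0 \<le> q" "q \<le> R"
      have d: "((\<lambda>q. sqrt (u\<^sup>2 + q)) has_real_derivative (inverse (sqrt (u\<^sup>2 + q)) / 2)) (at q)"
        using pos[OF q(1)] by (auto intro!: derivative_eq_intros simp: divide_simps)
      have "((\<lambda>q. 2 * pi * \<Phi> (sqrt (u\<^sup>2 + q))) has_real_derivative
          2 * pi * (\<phi> (sqrt (u\<^sup>2 + q)) * (inverse (sqrt (u\<^sup>2 + q)) / 2))) (at q)"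
        by (intro DERIV_cmult DERIV_chain2[OF deriv d])
      moreover have "2 * pi * (a * (inverse c / 2)) = pi * (a / c)" for a c :: real
        by (cases "c = 0") (simp_all add: field_simps)
      ultimately have "((\<lambda>q. 2 * pi * \<Phi> (sqrt (u\<^sup>2 + q))) has_real_derivative
          pi * (\<phi> (sqrt (u\<^sup>2 + q)) / sqrt (u\<^sup>2 + q))) (at q within {0..R})"
        by (simp only: has_field_derivative_at_within)
      then show "((\<lambda>q. 2 * pi * \<Phi> (sqrt (u\<^sup>2 + q))) has_vector_derivative
          pi * (\<phi> (sqrt (u\<^sup>2 + q)) / sqrt (u\<^sup>2 + q))) (at q within {0..R})"
        by (simp add: has_real_derivative_iff_has_vector_derivative)
    next
      show "continuous_on {0..R} (\<lambda>q. pi * (\<phi> (sqrt (u\<^sup>2 + q)) / sqrt (u\<^sup>2 + q)))"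
        using pos by (intro continuous_intros continuous_on_compose2[OF cont])
          (auto simp: less_imp_neq[symmetric] dest: less_imp_neq)
    qed
    moreover have "r\<^sup>2 - \<rho>\<^sup>2 - 2 * u * \<rho> = u\<^sup>2 + R" "u\<^sup>2 + 0 = u\<^sup>2"
      by (simp_all add: R_def power2_eq_square algebra_simps)
    moreover have "(\<lambda>q. (pi * indicator {0..} q) *\<^sub>R g u q) =
        (\<lambda>q. indicator {0..R} q *\<^sub>R (pi * (\<phi> (sqrt (u\<^sup>2 + q)) / sqrt (u\<^sup>2 + q))))"
      by (auto simp: g_def R_def fun_eq_iff indicator_def)
    moreover have "indicator {-\<rho>-r..r-\<rho>} u = (1::real)" using True mem by simp
    ultimately show ?thesis by (simp only: right_diff_distrib real_sqrt_abs mult_1)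
  next
    case False
    then have "(\<lambda>q. (pi * indicator {0..} q) *\<^sub>R g u q) = (\<lambda>_. 0)"
      by (auto simp: g_def R_def fun_eq_iff)
    then show ?thesis using False mem by (simp add: has_bochner_integral_zero)
  qed
  then show ?thesis
    by (intro has_bochner_integral_density) (auto simp: g_def)
qed

text \<open>Fubini in cylindrical coordinates reduces the integral to the slices just computed; the
  slice u = 0 is a null set. The bound on \<phi> supplies the integrability that Fubini
  requires.\<close>

lemma kernel_integral_axis:
  fixes \<phi> \<Phi> :: "real \<Rightarrow> real" and \<rho> r :: real
  assumes deriv: "\<And>t. (\<Phi> has_real_derivative \<phi> t) (at t)" and cont: "continuous_on UNIV \<phi>"
    and bd: "\<And>t. \<bar>\<phi> t\<bar> \<le> 1" and r: "r > 0"
  shows "has_bochner_integral lborel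
      (\<lambda>z::real^3. indicator (cball (- (\<rho> *\<^sub>R axis 1 1)) r) z * (\<phi> (norm z) / norm z))
      (\<integral>u. indicator {-\<rho>-r..r-\<rho>} u * (2 * pi * (\<Phi> (sqrt (r\<^sup>2 - \<rho>\<^sup>2 - 2 * u * \<rho>)) - \<Phi> \<bar>u\<bar>)) \<partial>lborel)"
proof -
  define g where "g \<phi> = (\<lambda>(u, q). if 0 \<le> q \<and> (u + \<rho>)\<^sup>2 + q \<le> r\<^sup>2 then \<phi> (sqrt (u\<^sup>2 + q)) / sqrt (u\<^sup>2 + q) else 0)"
    for \<phi> :: "real \<Rightarrow> real"
  define W where "W \<Phi> u = indicator {-\<rho>-r..r-\<rho>} u * (2 * pi * (\<Phi> (sqrt (r\<^sup>2 - \<rho>\<^sup>2 - 2 * u * \<rho>)) - \<Phi> \<bar>u\<bar>))"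
    for \<Phi> :: "real \<Rightarrow> real" and u
  let ?Q = "density lborel (\<lambda>q::real. ennreal (pi * indicator {0..} q))"
  interpret Q: sigma_finite_measure ?Q
    by (subst sigma_finite_measure.sigma_finite_iff_density_finite[OF sigma_finite_lborel]) auto
  interpret P: pair_sigma_finite "lborel :: real measure" ?Q ..
  have [measurable]: "\<phi> \<in> borel_measurable borel" using cont by (rule borel_measurable_continuous_onI)
  have meas[measurable]: "g \<phi> \<in> borel_measurable (borel \<Otimes>\<^sub>M borel)" if [measurable]: "\<phi> \<in> borel_measurable borel" for \<phi>
    unfolding g_def by measurable
  have inner: "has_bochner_integral ?Q (\<lambda>q. g \<phi> (u, q)) (W \<Phi> u)"
    if "\<And>t. (\<Phi> has_real_derivative \<phi> t) (at t)" "continuous_on UNIV \<phi>" "u \<noteq> 0" for \<phi> \<Phi> :: "real \<Rightarrow> real" and u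
    using kernel_integral_inner[OF that(1,2) r that(3)] unfolding g_def W_def by simp
  have Wint: "integrable lborel (W \<Phi>)" if "continuous_on UNIV \<Phi>" for \<Phi>
  proof -
    have "integrable lborel (\<lambda>u. indicator {-\<rho>-r..r-\<rho>} u *\<^sub>R (2 * pi * (\<Phi> (sqrt (r\<^sup>2 - \<rho>\<^sup>2 - 2 * u * \<rho>)) - \<Phi> \<bar>u\<bar>)))"
      by (rule borel_integrable_compact) (auto intro!: continuous_intros continuous_on_compose2[OF that])
    then show ?thesis unfolding W_def by simp
  qed
  have AE0: "AE u in lborel. u \<noteq> (0::real)" by (rule AE_lborel_singleton)
  \<comment> \<open>Numerator 1, with the identity as antiderivative, gives the Newtonian kernel
    1/|z|. It is nonnegative with explicit, integrable slice integrals, hence integrable on the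
    ball, and it dominates every kernel with |\<phi>| \<le> 1.\<close>
  define one where "one = (\<lambda>_::real. 1::real)"
  have [measurable]: "one \<in> borel_measurable borel" by (simp add: one_def)
  have one: "has_bochner_integral ?Q (\<lambda>q. g one (u, q)) (W (\<lambda>t. t) u)" if "u \<noteq> 0" for u
    by (rule inner[OF _ _ that]) (auto simp: one_def)
  have pos1: "g one p \<ge> 0" for p by (auto simp: g_def one_def split: prod.split)
  have int1: "integrable (lborel \<Otimes>\<^sub>M ?Q) (g one)"
  proof (rule P.Fubini_integrable)
    show "g one \<in> borel_measurable (lborel \<Otimes>\<^sub>M ?Q)" by measurable
    have "AE u in lborel. W (\<lambda>t. t) u = (\<integral>q. norm (g one (u, q)) \<partial>?Q)"
      using AE0 by eventually_elim (use one pos1 in \<open>auto simp: has_bochner_integral_iff\<close>)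
    moreover have "integrable lborel (W (\<lambda>t. t))" by (rule Wint) (intro continuous_intros)
    ultimately show "integrable lborel (\<lambda>u. \<integral>q. norm (g one (u, q)) \<partial>?Q)"
      by (subst integrable_cong_AE[symmetric]) auto
    show "AE u in lborel. integrable ?Q (\<lambda>q. g one (u, q))"
      using AE0 by eventually_elim (use one in \<open>auto simp: has_bochner_integral_iff\<close>)
  qed
  have int: "integrable (lborel \<Otimes>\<^sub>M ?Q) (g \<phi>)"
  proof (rule Bochner_Integration.integrable_bound[OF int1])
    show "AE p in lborel \<Otimes>\<^sub>M ?Q. norm (g \<phi> p) \<le> norm (g one p)"
      using bd by (auto simp: g_def one_def abs_divide intro!: AE_I2 divide_right_mono split: prod.split)
  qed measurable
  have "integral\<^sup>L (lborel \<Otimes>\<^sub>M ?Q) (g \<phi>) = (\<integral>u. (\<integral>q. g \<phi> (u, q) \<partial>?Q) \<partial>lborel)"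
    by (rule P.integral_fst'[OF int, symmetric])
  also have "\<dots> = (\<integral>u. W \<Phi> u \<partial>lborel)"
  proof (rule integral_cong_AE)
    have "continuous_on UNIV \<Phi>" using deriv by (intro DERIV_continuous_on) (auto intro: has_field_derivative_at_within)
    then show "W \<Phi> \<in> borel_measurable lborel" using Wint by blast
    show "AE u in lborel. (\<integral>q. g \<phi> (u, q) \<partial>?Q) = W \<Phi> u"
      using AE0 by eventually_elim (use inner[OF deriv cont] in \<open>auto simp: has_bochner_integral_iff\<close>)
  qed measurable
  finally have "has_bochner_integral (lborel \<Otimes>\<^sub>M ?Q) (g \<phi>) (\<integral>u. W \<Phi> u \<partial>lborel)"
    using int by (simp add: has_bochner_integral_iff)
  moreover have cyl: "(\<lambda>z::real^3. (z $ 1, (z $ 2)\<^sup>2 + (z $ 3)\<^sup>2)) \<in> measurable lborel borel"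
    using borel_measurable_continuous_onI[of "\<lambda>z::real^3. (z $ 1, (z $ 2)\<^sup>2 + (z $ 3)\<^sup>2)"]
    by (auto intro!: continuous_intros)
  moreover have "g \<phi> \<in> borel_measurable borel" using meas[of \<phi>] by (simp add: borel_prod)
  ultimately have "has_bochner_integral lborel (\<lambda>z::real^3. g \<phi> (z $ 1, (z $ 2)\<^sup>2 + (z $ 3)\<^sup>2)) (\<integral>u. W \<Phi> u \<partial>lborel)"
    unfolding distr_lborel_cylindrical[symmetric]
    by (simp add: has_bochner_integral_iff integrable_distr_eq integral_distr)
  moreover have "g \<phi> (z $ 1, (z $ 2)\<^sup>2 + (z $ 3)\<^sup>2)
      = indicator (cball (- (\<rho> *\<^sub>R axis 1 1)) r) z * (\<phi> (norm z) / norm z)" for z :: "real^3"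
  proof -
    have n: "norm z = sqrt ((z $ 1)\<^sup>2 + ((z $ 2)\<^sup>2 + (z $ 3)\<^sup>2))" for z :: "real^3"
      by (simp add: norm_vec_def L2_set_def sum_3 add_ac)
    have "z \<in> cball (- (\<rho> *\<^sub>R axis 1 1)) r \<longleftrightarrow> norm (z + \<rho> *\<^sub>R axis 1 1) \<le> r"
      by (simp add: dist_norm norm_minus_commute)
    also have "\<dots> \<longleftrightarrow> (z $ 1 + \<rho>)\<^sup>2 + ((z $ 2)\<^sup>2 + (z $ 3)\<^sup>2) \<le> r\<^sup>2"
    proof -
      have "sqrt a \<le> r \<longleftrightarrow> a \<le> r\<^sup>2" for a
        using real_sqrt_le_iff[of a "r\<^sup>2"] r by simp
      then show ?thesis unfolding n by (simp add: axis_def)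
    qed
    finally show ?thesis unfolding g_def by (simp add: n)
  qed
  ultimately show ?thesis unfolding W_def by simp
qed

text \<open>A rigid motion reduces to the previous configuration: translate x to the origin and
  rotate so that x - x0 points along the first axis. The centre x0 then becomes -\<rho> times the
  first unit vector.\<close>

lemma kernel_bochner_integral_cball:
  fixes \<phi> \<Phi> :: "real \<Rightarrow> real" and r :: real and x x0 :: "real^3"
  defines "\<rho> \<equiv> dist x x0"
  assumes deriv: "\<And>t. (\<Phi> has_real_derivative \<phi> t) (at t)" and cont: "continuous_on UNIV \<phi>"
    and bd: "\<And>t. \<bar>\<phi> t\<bar> \<le> 1" and r: "r > 0"
  shows "has_bochner_integral lborel (\<lambda>y. indicator (cball x0 r) y * (\<phi> (dist y x) / dist y x))
      (\<integral>u. indicator {-\<rho>-r..r-\<rho>} u * (2 * pi * (\<Phi> (sqrt (r\<^sup>2 - \<rho>\<^sup>2 - 2 * u * \<rho>)) - \<Phi> \<bar>u\<bar>)) \<partial>lborel)"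
    (is "has_bochner_integral _ _ ?V")
proof -
  have "norm (\<rho> *\<^sub>R axis 1 1 :: real^3) = norm (x - x0)"
    by (simp add: \<rho>_def dist_norm)
  then obtain A :: "real^3 \<Rightarrow> real^3" where A: "orthogonal_transformation A" "A (\<rho> *\<^sub>R axis 1 1) = x - x0"
    by (rule orthogonal_transformation_exists)
  have lin: "linear A" using A(1) by (rule orthogonal_transformation_linear)
  have [measurable]: "A \<in> borel_measurable borel" "\<phi> \<in> borel_measurable borel"
    using lin cont by (auto intro!: borel_measurable_continuous_onI simp: linear_continuous_on linear_conv_bounded_linear)
  have d: "distr lborel borel (\<lambda>z. x + A z) = lborel"
  proof -
    have "distr lborel borel (\<lambda>z. x + A z) = distr (distr lborel borel A) borel ((+) x)"
      by (subst distr_distr) (auto simp: o_def)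
    then show ?thesis by (simp add: distr_lborel_orthogonal[OF A(1)] lborel_distr_plus)
  qed
  let ?f = "\<lambda>y. indicator (cball x0 r) y * (\<phi> (dist y x) / dist y x)"
  have [measurable]: "(\<lambda>y. dist y x) \<in> borel_measurable borel"
    by (intro borel_measurable_continuous_onI continuous_intros)
  have [measurable]: "(\<lambda>y. \<phi> (dist y x)) \<in> borel_measurable borel"
    by (rule measurable_compose[of _ _ borel]) auto
  have "cball x0 r \<in> sets borel" by simp
  then have f[measurable]: "?f \<in> borel_measurable borel"
    by (intro borel_measurable_times borel_measurable_indicator borel_measurable_divide) auto
  have "?f (x + A z) = indicator (cball (- (\<rho> *\<^sub>R axis 1 1)) r) z * (\<phi> (norm z) / norm z)" for z
  proof -
    have n: "norm (A w) = norm w" for w using A(1) by (simp add: orthogonal_transformation)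
    have "dist x0 (x + A z) = norm (A z + A (\<rho> *\<^sub>R axis 1 1))"
      unfolding A(2) by (simp add: dist_norm norm_minus_commute algebra_simps)
    also have "\<dots> = dist (- (\<rho> *\<^sub>R axis 1 1)) z"
      unfolding linear_add[OF lin, symmetric] n by (simp add: dist_norm norm_minus_commute)
    finally show ?thesis by (simp add: dist_norm n indicator_def)
  qed
  then have "has_bochner_integral lborel (\<lambda>z. ?f (x + A z)) ?V"
    using kernel_integral_axis[OF deriv cont bd r, of \<rho>] by simp
  then have "has_bochner_integral (distr lborel borel (\<lambda>z. x + A z)) ?f ?V"
    by (intro has_bochner_integral_distr f) auto
  then show ?thesis unfolding d .
qed

lemma kernel_has_integral_ball:
  fixes \<phi> \<Phi> :: "real \<Rightarrow> real" and r :: real and x x0 :: "real^3"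
  defines "\<rho> \<equiv> dist x x0"
  assumes "\<And>t. (\<Phi> has_real_derivative \<phi> t) (at t)" "continuous_on UNIV \<phi>"
    and "\<And>t. \<bar>\<phi> t\<bar> \<le> 1" "r > 0"
  shows "((\<lambda>y. \<phi> (dist y x) / dist y x) has_integral
      (\<integral>u. indicator {-\<rho>-r..r-\<rho>} u * (2 * pi * (\<Phi> (sqrt (r\<^sup>2 - \<rho>\<^sup>2 - 2 * u * \<rho>)) - \<Phi> \<bar>u\<bar>)) \<partial>lborel))
      (ball x0 r)"
    (is "(_ has_integral ?V) _")
proof -
  let ?f = "\<lambda>y. indicator (cball x0 r) y * (\<phi> (dist y x) / dist y x)"
  have "(?f has_integral ?V) UNIV"
    using kernel_bochner_integral_cball[OF assms(2-), of x0 x] unfolding \<rho>_def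
    by (auto simp: has_bochner_integral_iff dest: has_integral_integral_lborel)
  moreover have "?f = (\<lambda>y. if y \<in> cball x0 r then \<phi> (dist y x) / dist y x else 0)"
    by (auto simp: fun_eq_iff)
  ultimately have "((\<lambda>y. \<phi> (dist y x) / dist y x) has_integral ?V) (cball x0 r)"
    using has_integral_restrict_UNIV[of "cball x0 r" "\<lambda>y. \<phi> (dist y x) / dist y x" ?V]
    by (simp only:)
  then show ?thesis
    by (subst has_integral_spike_set_eq[where T = "cball x0 r"])
       (auto intro!: negligible_subset[OF negligible_sphere[of x0 r]])
qed

text \<open>A large ball centred at the singularity x contains D, and the kernel is absolutely
  integrable on that ball, hence on D.\<close>

lemma kernel_integrable_on:
  fixes \<phi> \<Phi> :: "real \<Rightarrow> real" and D :: "(real^3) set"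
  assumes "\<And>t. (\<Phi> has_real_derivative \<phi> t) (at t)" "continuous_on UNIV \<phi>"
    and "\<And>t. \<bar>\<phi> t\<bar> \<le> 1" and D: "open D" "bounded D"
  shows "(\<lambda>y. \<phi> (dist y x) / dist y x) integrable_on D"
proof -
  obtain r where r: "r > 0" "D \<subseteq> ball x r"
    using bounded_subset_ballD[OF D(2)] by blast
  have "integrable lborel (\<lambda>y. indicator (cball x r) y *\<^sub>R (\<phi> (dist y x) / dist y x))"
    using kernel_bochner_integral_cball[OF assms(1-3) r(1), of x x] by (auto simp: has_bochner_integral_iff)
  then have "(\<lambda>y. \<phi> (dist y x) / dist y x) absolutely_integrable_on cball x r"
    unfolding set_integrable_def by (subst integrable_completion) auto
  then have "(\<lambda>y. \<phi> (dist y x) / dist y x) absolutely_integrable_on D"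
    by (rule set_integrable_subset) (use r D in auto)
  then show ?thesis by (rule set_lebesgue_integral_eq_integral)
qed

lemma sin_kernel_has_integral_ball:
  fixes lam r :: real and x0 :: "real^3"
  assumes lam: "lam > 0" and r: "r > 0"
  shows "((\<lambda>y. sin (lam * dist y x0) / dist y x0) has_integral
      4 * pi / lam\<^sup>2 * (sin (lam * r) - lam * r * cos (lam * r))) (ball x0 r)"
proof -
  define \<Phi> where "\<Phi> t = - cos (lam * t) / lam" for t
  \<comment> \<open>For \<rho> = 0 the square root is constantly r. Since cosine is even, the
    absolute value in \<Phi> disappears and one smooth antiderivative serves the whole
    interval.\<close>
  let ?G = "\<lambda>u. 2 * pi * (\<Phi> r * u + sin (lam * u) / lam\<^sup>2)"
  have "((\<lambda>y. sin (lam * dist y x0) / dist y x0) has_integral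
      (\<integral>u. indicator {- dist x0 x0 - r..r - dist x0 x0} u *
        (2 * pi * (\<Phi> (sqrt (r\<^sup>2 - (dist x0 x0)\<^sup>2 - 2 * u * dist x0 x0)) - \<Phi> \<bar>u\<bar>)) \<partial>lborel)) (ball x0 r)"
    by (rule kernel_has_integral_ball[OF _ _ _ r])
       (use lam in \<open>auto simp: \<Phi>_def intro!: derivative_eq_intros continuous_intros\<close>)
  moreover have "(\<integral>u. indicator {- r..r} u *\<^sub>R (2 * pi * (\<Phi> r - \<Phi> \<bar>u\<bar>)) \<partial>lborel) = ?G r - ?G (- r)"
  proof (rule integral_FTC_Icc)
    fix u :: real
    have "(?G has_real_derivative 2 * pi * (\<Phi> r - \<Phi> \<bar>u\<bar>)) (at u)"
      using lam by (auto simp: \<Phi>_def abs_if field_simps power2_eq_square intro!: derivative_eq_intros)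
    then show "(?G has_vector_derivative 2 * pi * (\<Phi> r - \<Phi> \<bar>u\<bar>)) (at u within {-r..r})"
      by (simp add: has_real_derivative_iff_has_vector_derivative has_vector_derivative_at_within)
  qed (use r lam in \<open>auto simp: \<Phi>_def intro!: continuous_intros\<close>)
  moreover have "?G r - ?G (- r) = 4 * pi / lam\<^sup>2 * (sin (lam * r) - lam * r * cos (lam * r))"
    using lam by (simp add: \<Phi>_def field_simps power2_eq_square)
  ultimately show ?thesis using r by simp
qed

lemma sin_kernel_integrable_on:
  fixes D :: "(real^3) set"
  assumes lam: "lam > 0" and D: "open D" "bounded D"
  shows "(\<lambda>y. sin (lam * dist y x) / dist y x) integrable_on D"
  by (rule kernel_integrable_on[OF _ _ _ D, where \<Phi> = "\<lambda>t. - cos (lam * t) / lam"])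
     (use lam in \<open>auto intro!: derivative_eq_intros continuous_intros\<close>)

lemma cos_kernel_integrable_on:
  fixes D :: "(real^3) set"
  assumes lam: "lam > 0" and D: "open D" "bounded D"
  shows "(\<lambda>y. cos (lam * dist y x) / dist y x) integrable_on D"
  by (rule kernel_integrable_on[OF _ _ _ D, where \<Phi> = "\<lambda>t. sin (lam * t) / lam"])
     (use lam in \<open>auto intro!: derivative_eq_intros continuous_intros\<close>)

text \<open>The first summand is the field of a point source at the centre. The second one solves the
  radial Helmholtz equation with right-hand side \<open>-4\<pi>\<close> and has vanishing Cauchy data on
  the sphere of radius \<open>r\<close>; its sign is what excludes holes in the ball.\<close>
lemma cos_kernel_has_integral_ball:
  fixes lam r :: real and x x0 :: "real^3"
  defines "\<rho> \<equiv> dist x x0"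
  assumes lam: "lam > 0" and rho: "0 < \<rho>" "\<rho> < r"
  shows "((\<lambda>y. cos (lam * dist y x) / dist y x) has_integral
      4 * pi / lam ^ 3 * (sin (lam * r) - lam * r * cos (lam * r)) * cos (lam * \<rho>) / \<rho>
      - 4 * pi / (lam ^ 3 * \<rho>) * (lam * \<rho> - lam * r * cos (lam * (r - \<rho>)) + sin (lam * (r - \<rho>)))) (ball x0 r)"
proof -
  have r: "r > 0" using rho by simp
  define \<Phi> where "\<Phi> t = sin (lam * t) / lam" for t
  \<comment> \<open>\<open>s u\<close> is the distance from x to the circle in which the slice at u
    meets the sphere. \<open>H\<close> is an antiderivative of c sin(lam c), the factor c coming
    from the change of variable u to \<open>s u\<close>; \<open>K\<close> is an antiderivative of
    \<open>\<Phi> \<bar>u\<bar>\<close>.\<close>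
  define s where "s u = sqrt (r\<^sup>2 - \<rho>\<^sup>2 - 2 * u * \<rho>)" for u
  define H where "H c = sin (lam * c) / lam\<^sup>2 - c * cos (lam * c) / lam" for c
  define K where "K u = (if u \<le> 0 then cos (lam * u) - 1 else 1 - cos (lam * u)) / lam\<^sup>2" for u
  let ?G = "\<lambda>u. 2 * pi * (- H (s u) / (lam * \<rho>) - K u)"
  have "((\<lambda>y. cos (lam * dist y x) / dist y x) has_integral
      (\<integral>u. indicator {- dist x x0 - r..r - dist x x0} u *
        (2 * pi * (\<Phi> (sqrt (r\<^sup>2 - (dist x x0)\<^sup>2 - 2 * u * dist x x0)) - \<Phi> \<bar>u\<bar>)) \<partial>lborel)) (ball x0 r)"
    by (rule kernel_has_integral_ball[OF _ _ _ r])
       (use lam in \<open>auto simp: \<Phi>_def intro!: derivative_eq_intros continuous_intros\<close>)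
  moreover have "(\<integral>u. indicator {- \<rho> - r..r - \<rho>} u *\<^sub>R (2 * pi * (\<Phi> (s u) - \<Phi> \<bar>u\<bar>)) \<partial>lborel)
      = ?G (r - \<rho>) - ?G (- \<rho> - r)"
  proof (rule integral_FTC_Icc)
    show "- \<rho> - r \<le> r - \<rho>" using r by simp
    fix u :: real assume u: "- \<rho> - r \<le> u" "u \<le> r - \<rho>"
    \<comment> \<open>The radicand is at least (r - \<rho>)^2. As x lies strictly inside the ball
      this is positive, and \<open>s\<close> is differentiable up to the endpoints.\<close>
    have "2 * u * \<rho> \<le> 2 * (r - \<rho>) * \<rho>" using u rho by simp
    moreover have "(r - \<rho>)\<^sup>2 > 0" using rho by simp
    ultimately have pos: "r\<^sup>2 - \<rho>\<^sup>2 - 2 * u * \<rho> > 0"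
      by (simp add: power2_eq_square algebra_simps)
    have spos: "s u > 0" using pos by (simp add: s_def)
    have ds: "(s has_real_derivative - \<rho> / s u) (at u)"
      unfolding s_def[abs_def] using pos by (auto intro!: derivative_eq_intros simp: divide_simps)
    have dH: "(H has_real_derivative c * sin (lam * c)) (at c)" for c
      unfolding H_def[abs_def] using lam by (auto intro!: derivative_eq_intros simp: field_simps power2_eq_square)
    have dHs: "((\<lambda>u. H (s u)) has_real_derivative (s u * sin (lam * s u)) * (- \<rho> / s u)) (at u)"
      by (rule DERIV_chain2[OF dH ds])
    \<comment> \<open>\<open>\<Phi> \<bar>u\<bar>\<close> has a kink at 0, so the two branches of
      \<open>K\<close> are glued there; both branches vanish at 0 and so do their
      derivatives.\<close>
    have dK: "(K has_real_derivative \<Phi> \<bar>u\<bar>) (at u within {- \<rho> - r..r - \<rho>})"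
    proof -
      have "((\<lambda>u. if u \<in> {..0} then (cos (lam * u) - 1) / lam\<^sup>2 else (1 - cos (lam * u)) / lam\<^sup>2)
        has_vector_derivative (if u \<in> {..0} then - sin (lam * u) / lam else sin (lam * u) / lam)) (at u within {..0} \<union> {0..})"
        by (rule has_vector_derivative_If_within_closures[where g="\<lambda>u. (1 - cos (lam * u)) / lam\<^sup>2"])
           (use lam in \<open>auto simp: has_real_derivative_iff_has_vector_derivative[symmetric] field_simps power2_eq_square intro!: derivative_eq_intros\<close>)
      moreover have "(if u \<in> {..0} then - sin (lam * u) / lam else sin (lam * u) / lam) = \<Phi> \<bar>u\<bar>"
        by (auto simp: \<Phi>_def)
      moreover have "(\<lambda>u. if u \<in> {..0} then (cos (lam * u) - 1) / lam\<^sup>2 else (1 - cos (lam * u)) / lam\<^sup>2) = K"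
        by (auto simp: K_def fun_eq_iff)
      ultimately have "(K has_vector_derivative \<Phi> \<bar>u\<bar>) (at u within {..0} \<union> {0..})" by simp
      then have "(K has_vector_derivative \<Phi> \<bar>u\<bar>) (at u within {- \<rho> - r..r - \<rho>})"
        by (rule has_vector_derivative_within_subset) auto
      then show ?thesis by (simp add: has_real_derivative_iff_has_vector_derivative)
    qed
    have "(?G has_real_derivative 2 * pi * (\<Phi> (s u) - \<Phi> \<bar>u\<bar>)) (at u within {- \<rho> - r..r - \<rho>})"
      using DERIV_cmult[OF DERIV_diff[OF DERIV_cdivide[OF DERIV_minus[OF
          has_field_derivative_at_within[OF dHs]], where c = "lam * \<rho>"] dK], of "2 * pi"]
      by (rule DERIV_cong) (use spos lam rho in \<open>simp add: \<Phi>_def field_simps\<close>)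
    then show "(?G has_vector_derivative 2 * pi * (\<Phi> (s u) - \<Phi> \<bar>u\<bar>)) (at u within {- \<rho> - r..r - \<rho>})"
      by (simp add: has_real_derivative_iff_has_vector_derivative)
  qed (use lam in \<open>auto simp: \<Phi>_def s_def intro!: continuous_intros\<close>)
  \<comment> \<open>The endpoints of the u-interval are the points of the sphere nearest to and
    farthest from x, at distances r - \<rho> and r + \<rho>.\<close>
  moreover have s1: "s (r - \<rho>) = r - \<rho>"
  proof -
    have "r\<^sup>2 - \<rho>\<^sup>2 - 2 * (r - \<rho>) * \<rho> = (r - \<rho>)\<^sup>2" by (simp add: power2_eq_square algebra_simps)
    then show ?thesis using rho by (simp add: s_def)
  qed
  moreover have s2: "s (- \<rho> - r) = r + \<rho>"
  proof -
    have "r\<^sup>2 - \<rho>\<^sup>2 - 2 * (- \<rho> - r) * \<rho> = (r + \<rho>)\<^sup>2" by (simp add: power2_eq_square algebra_simps)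
    then show ?thesis using rho by (simp add: s_def)
  qed
  moreover have "?G (r - \<rho>) - ?G (- \<rho> - r) = 
      4 * pi / lam ^ 3 * (sin (lam * r) - lam * r * cos (lam * r)) * cos (lam * \<rho>) / \<rho>
      - 4 * pi / (lam ^ 3 * \<rho>) * (lam * \<rho> - lam * r * cos (lam * (r - \<rho>)) + sin (lam * (r - \<rho>)))"
  proof -
    have c: "cos (lam * (- \<rho> - r)) = cos (lam * (r + \<rho>))"
    proof -
      have "lam * (- \<rho> - r) = - (lam * (r + \<rho>))" by (simp add: algebra_simps)
      then show ?thesis by (simp only: cos_minus)
    qed
    have K: "K (r - \<rho>) = (1 - cos (lam * (r - \<rho>))) / lam\<^sup>2" "K (- \<rho> - r) = (cos (lam * (r + \<rho>)) - 1) / lam\<^sup>2"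
      using rho by (auto simp: K_def c)
    show ?thesis unfolding s1 s2 K H_def using rho lam
      by (simp add: distrib_left right_diff_distrib' sin_add sin_diff cos_add cos_diff)
         (simp add: field_simps power2_eq_square power3_eq_cube)
  qed
  ultimately show ?thesis unfolding s_def[symmetric] \<rho>_def[symmetric] by simp
qed

subsection \<open>Analytic continuation of the sine kernel\<close>

lemma continuous_integrable_on_open_bounded:
  fixes f :: "'a::euclidean_space \<Rightarrow> 'b::euclidean_space"
  assumes "continuous_on UNIV f" "open D" "bounded D"
  shows "f integrable_on D"
proof -
  obtain a where a: "D \<subseteq> cbox (- a) a" using bounded_subset_cbox_symmetric[OF assms(3)] by blast
  have "f absolutely_integrable_on cbox (- a) a"
    by (rule absolutely_integrable_continuous) (use assms(1) continuous_on_subset in blast)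
  moreover have "D \<in> sets lebesgue" using assms(2) by simp
  ultimately have "f absolutely_integrable_on D" using a by (rule set_integrable_subset)
  then show ?thesis by (rule set_lebesgue_integral_eq_integral)
qed

text \<open>Splitting off one factor of the power moves t outside the integrals, while b and c are
  absorbed into the weight. This is why the induction generalises over w; no differentiation under
  the integral is involved.\<close>

lemma holomorphic_integral_quadratic_power:
  fixes D :: "'a::euclidean_space set" and b c :: "'a \<Rightarrow> complex"
  assumes D: "open D" "bounded D" and b: "continuous_on UNIV b" and c: "continuous_on UNIV c"
    and w: "continuous_on UNIV w"
  shows "(\<lambda>t. integral D (\<lambda>y. w y * (t\<^sup>2 - 2 * t * b y + c y) ^ k)) holomorphic_on UNIV"
  using w
proof (induction k arbitrary: w)
  case 0
  show ?case by simp
next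
  case (Suc k)
  let ?q = "\<lambda>t y. t\<^sup>2 - 2 * t * b y + c y"
  have int: "(\<lambda>y. v y * ?q t y ^ k) integrable_on D" if "continuous_on UNIV v" for v t
    by (rule continuous_integrable_on_open_bounded[OF _ D]) (intro continuous_intros that b c)
  have wb: "continuous_on UNIV (\<lambda>y. w y * b y)" and wc: "continuous_on UNIV (\<lambda>y. w y * c y)"
    using Suc.prems b c by (auto intro!: continuous_intros)
  have "integral D (\<lambda>y. w y * ?q t y ^ Suc k) =
      t\<^sup>2 * integral D (\<lambda>y. w y * ?q t y ^ k) - 2 * t * integral D (\<lambda>y. w y * b y * ?q t y ^ k)
      + integral D (\<lambda>y. w y * c y * ?q t y ^ k)" for t
  proof -
    have "((\<lambda>y. t\<^sup>2 * (w y * ?q t y ^ k) - 2 * t * (w y * b y * ?q t y ^ k) + w y * c y * ?q t y ^ k) has_integral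
      t\<^sup>2 * integral D (\<lambda>y. w y * ?q t y ^ k) - 2 * t * integral D (\<lambda>y. w y * b y * ?q t y ^ k)
      + integral D (\<lambda>y. w y * c y * ?q t y ^ k)) D"
      by (intro has_integral_add has_integral_diff has_integral_mult_right integrable_integral
          int Suc.prems wb wc)
    moreover have "(\<lambda>y. t\<^sup>2 * (w y * ?q t y ^ k) - 2 * t * (w y * b y * ?q t y ^ k) + w y * c y * ?q t y ^ k)
      = (\<lambda>y. w y * ?q t y ^ Suc k)"
      by (simp add: algebra_simps)
    ultimately show ?thesis by (simp add: integral_unique)
  qed
  then show ?case
    using Suc.IH[OF Suc.prems] Suc.IH[OF wb] Suc.IH[OF wc] by (auto intro!: holomorphic_intros)
qed

definition sinc_coeff :: "real \<Rightarrow> nat \<Rightarrow> real" where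
  "sinc_coeff lam k = (-1) ^ k * lam ^ (2 * k + 1) / fact (2 * k + 1)"

text \<open>The entire function \<open>z \<mapsto> sin (\<lambda>\<surd>z) / \<surd>z\<close>.\<close>
definition sinc_sqrt :: "real \<Rightarrow> complex \<Rightarrow> complex" where
  "sinc_sqrt lam z = (\<Sum>k. complex_of_real (sinc_coeff lam k) * z ^ k)"

text \<open>Since (2k+1)! \<ge> k!, the exponential series at lam^2 M is a majorant up to the factor
  |lam|.\<close>

lemma summable_sinc_coeff:
  assumes "M \<ge> 0"
  shows "summable (\<lambda>k. \<bar>sinc_coeff lam k\<bar> * M ^ k)"
proof (rule summable_comparison_test')
  show "summable (\<lambda>k. \<bar>lam\<bar> * (inverse (fact k) * (lam\<^sup>2 * M) ^ k))"
    by (intro summable_mult summable_exp)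
  fix k :: nat assume "k \<ge> 0"
  have "(fact k :: real) \<le> fact (2 * k + 1)" by (rule fact_mono) auto
  then have "\<bar>lam\<bar> ^ (2 * k + 1) * M ^ k / fact (2 * k + 1) \<le> \<bar>lam\<bar> ^ (2 * k + 1) * M ^ k / fact k"
    using assms by (intro divide_left_mono) auto
  moreover have "\<bar>lam\<bar> ^ (2 * k + 1) = \<bar>lam\<bar> * (lam\<^sup>2) ^ k"
    using power_mult[of "\<bar>lam\<bar>" 2 k] by simp
  moreover have "\<bar>sinc_coeff lam k\<bar> = \<bar>lam\<bar> ^ (2 * k + 1) / fact (2 * k + 1)"
    by (simp add: sinc_coeff_def abs_mult power_abs del: fact_Suc)
  ultimately have "\<bar>sinc_coeff lam k\<bar> * M ^ k \<le> \<bar>lam\<bar> * (lam\<^sup>2) ^ k * M ^ k / fact k"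
    by (simp only: times_divide_eq_left)
  then show "norm (\<bar>sinc_coeff lam k\<bar> * M ^ k) \<le> \<bar>lam\<bar> * (inverse (fact k) * (lam\<^sup>2 * M) ^ k)"
    using assms by (simp add: power_mult_distrib divide_inverse mult_ac)
qed

lemma uniform_limit_sinc_sqrt:
  assumes "M \<ge> 0"
  shows "uniform_limit (cball 0 M) (\<lambda>n z. \<Sum>k<n. complex_of_real (sinc_coeff lam k) * z ^ k) (sinc_sqrt lam) sequentially"
  unfolding sinc_sqrt_def[abs_def]
  by (rule Weierstrass_m_test[OF _ summable_sinc_coeff[OF assms, of lam]])
     (use assms in \<open>auto simp: norm_mult norm_power intro!: mult_left_mono power_mono\<close>)

lemma continuous_on_sinc_sqrt: "continuous_on UNIV (sinc_sqrt lam)"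
proof -
  have "summable (\<lambda>k. complex_of_real (sinc_coeff lam k) * z ^ k)" for z
    by (rule summable_norm_cancel) (use summable_sinc_coeff[of "norm z" lam] in \<open>simp add: norm_mult norm_power\<close>)
  then have "isCont (sinc_sqrt lam) z" for z
    unfolding sinc_sqrt_def[abs_def] by (rule isCont_powser_converges_everywhere)
  then show ?thesis by (simp add: continuous_at_imp_continuous_on)
qed

text \<open>The series has the limit value lam at the origin, whereas the quotient sin(lam s)/s is 0
  at s = 0 by the convention for division.\<close>

lemma sinc_sqrt_0: "sinc_sqrt lam 0 = complex_of_real lam"
  unfolding sinc_sqrt_def using powser_zero[of "\<lambda>k. complex_of_real (sinc_coeff lam k)"]
  by (simp add: sinc_coeff_def)

lemma sinc_sqrt_of_real_square:
  assumes "s \<noteq> 0"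
  shows "sinc_sqrt lam (complex_of_real (s\<^sup>2)) = complex_of_real (sin (lam * s) / s)"
proof -
  have "(\<lambda>k. inverse s * ((-1) ^ k / fact (2 * k + 1) * (lam * s) ^ (2 * k + 1))) sums (inverse s * sin (lam * s))"
    by (intro sums_mult sin_paired)
  moreover have "inverse s * ((-1) ^ k / fact (2 * k + 1) * (lam * s) ^ (2 * k + 1)) = sinc_coeff lam k * (s\<^sup>2) ^ k" for k
    using assms power_mult[of s 2 k] by (simp add: sinc_coeff_def power_mult_distrib del: fact_Suc)
  ultimately have "(\<lambda>k. sinc_coeff lam k * (s\<^sup>2) ^ k) sums (sin (lam * s) / s)"
    by (simp add: field_simps)
  then have "(\<lambda>k. complex_of_real (sinc_coeff lam k * (s\<^sup>2) ^ k)) sums complex_of_real (sin (lam * s) / s)"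
    by (rule sums_of_real)
  then show ?thesis unfolding sinc_sqrt_def by (simp add: sums_iff)
qed

lemma holomorphic_sinc_sqrt: "sinc_sqrt lam holomorphic_on UNIV"
proof (rule holomorphic_uniform_sequence)
  fix x :: complex
  have "uniform_limit (cball x 1) (\<lambda>n z. \<Sum>k<n. complex_of_real (sinc_coeff lam k) * z ^ k) (sinc_sqrt lam) sequentially"
    by (rule uniform_limit_on_subset[OF uniform_limit_sinc_sqrt[of "norm x + 1"]])
       (auto simp: subset_iff, smt (verit) dist_norm norm_triangle_sub norm_minus_commute)
  then show "\<exists>d>0. cball x d \<subseteq> UNIV \<and>
      uniform_limit (cball x d) (\<lambda>n z. \<Sum>k<n. complex_of_real (sinc_coeff lam k) * z ^ k) (sinc_sqrt lam) sequentially"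
    by (intro exI[of _ 1]) auto
qed (auto intro!: holomorphic_intros)

text \<open>The partial sums have holomorphic integrals by the polynomial case. On a disc of
  parameters t and for y in the bounded set D the quadratic stays in a fixed disc, so these
  integrals converge locally uniformly.\<close>

lemma holomorphic_integral_sinc_sqrt:
  fixes D :: "'a::euclidean_space set" and b c :: "'a \<Rightarrow> complex"
  assumes D: "open D" "bounded D" and b: "continuous_on UNIV b" and c: "continuous_on UNIV c"
  shows "(\<lambda>t. integral D (\<lambda>y. sinc_sqrt lam (t\<^sup>2 - 2 * t * b y + c y))) holomorphic_on UNIV"
proof (rule holomorphic_uniform_sequence)
  let ?q = "\<lambda>t y. t\<^sup>2 - 2 * t * b y + c y"
  let ?P = "\<lambda>n z. \<Sum>k<n. complex_of_real (sinc_coeff lam k) * z ^ k"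
  let ?F = "\<lambda>n t. integral D (\<lambda>y. ?P n (?q t y))"
  have contq: "continuous_on UNIV (?q t)" for t by (intro continuous_intros b c)
  have int: "(\<lambda>y. v (?q t y)) integrable_on D" if "continuous_on UNIV v" for v :: "complex \<Rightarrow> complex" and t
    by (rule continuous_integrable_on_open_bounded[OF _ D], rule continuous_on_compose2[OF that contq]) auto
  have lm: "D \<in> lmeasurable" using D by (simp add: lmeasurable_open bounded_set_imp_lmeasurable)
  show "?F n holomorphic_on UNIV" for n
  proof -
    have "?F n = (\<lambda>t. \<Sum>k<n. integral D (\<lambda>y. complex_of_real (sinc_coeff lam k) * ?q t y ^ k))"
      by (intro ext integral_sum) (auto intro!: int continuous_intros)
    then show ?thesis
      by (simp only:) (intro holomorphic_on_sum holomorphic_integral_quadratic_power D b c continuous_on_const)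
  qed
  fix x :: complex
  have cl: "compact (closure D)" using D by (simp add: compact_closure)
  have "bounded (b ` closure D)" "bounded (c ` closure D)"
    by (intro compact_imp_bounded compact_continuous_image continuous_on_subset[OF b] continuous_on_subset[OF c] cl; simp)+
  then obtain B C where B: "\<And>y. y \<in> closure D \<Longrightarrow> norm (b y) \<le> B" and C: "\<And>y. y \<in> closure D \<Longrightarrow> norm (c y) \<le> C"
    unfolding bounded_iff by auto
  define T where "T = norm x + 1"
  define M where "M = T\<^sup>2 + 2 * T * \<bar>B\<bar> + \<bar>C\<bar>"
  have M: "M \<ge> 0" unfolding M_def T_def by auto
  have qM: "norm (?q t y) \<le> M" if t: "t \<in> cball x 1" and y: "y \<in> D" for t y
  proof -
    have nt: "norm t \<le> T" using t norm_triangle_sub[of t x] by (simp add: T_def dist_norm norm_minus_commute)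
    have "norm (b y) \<le> \<bar>B\<bar>" "norm (c y) \<le> \<bar>C\<bar>" using B[of y] C[of y] y closure_subset by fastforce+
    then have "norm (t\<^sup>2) \<le> T\<^sup>2" "norm (2 * t * b y) \<le> 2 * T * \<bar>B\<bar>" "norm (c y) \<le> \<bar>C\<bar>"
      using nt order_trans[OF norm_ge_zero nt] by (auto simp: norm_mult norm_power intro!: power_mono mult_mono)
    then show ?thesis unfolding M_def
      using norm_triangle_ineq[of "t\<^sup>2 - 2 * t * b y" "c y"] norm_triangle_ineq4[of "t\<^sup>2" "2 * t * b y"] by linarith
  qed
  have "uniform_limit (cball x 1) ?F (\<lambda>t. integral D (\<lambda>y. sinc_sqrt lam (?q t y))) sequentially"
  proof (rule uniform_limitI)
    fix e :: real assume e: "e > 0"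
    define m where "m = measure lebesgue D"
    have m: "m \<ge> 0" by (simp add: m_def)
    \<comment> \<open>The 1 added to the volume m allows m = 0 and makes the final bound
      strict.\<close>
    have "e / (m + 1) > 0" using e m by simp
    from uniform_limitD[OF uniform_limit_sinc_sqrt[OF M, of lam] this]
    show "\<forall>\<^sub>F n in sequentially. \<forall>t\<in>cball x 1. dist (?F n t) (integral D (\<lambda>y. sinc_sqrt lam (?q t y))) < e"
    proof eventually_elim
      case (elim n)
      show ?case
      proof
        fix t assume t: "t \<in> cball x 1"
        have i1: "(\<lambda>y. ?P n (?q t y)) integrable_on D" and i2: "(\<lambda>y. sinc_sqrt lam (?q t y)) integrable_on D"
          by (rule int, intro continuous_intros) (rule int[OF continuous_on_sinc_sqrt])
        have c: "((\<lambda>y. e / (m + 1)) has_integral e / (m + 1) * m) D"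
          using has_integral_mult_right[OF integrable_integral[OF integrable_on_const[OF lm, of "1::real"]], of "e / (m + 1)"]
          by (simp add: m_def lmeasure_integral[OF lm])
        have "dist (?F n t) (integral D (\<lambda>y. sinc_sqrt lam (?q t y)))
            = norm (integral D (\<lambda>y. ?P n (?q t y) - sinc_sqrt lam (?q t y)))"
          by (simp add: dist_norm integral_diff[OF i1 i2])
        also have "\<dots> \<le> integral D (\<lambda>y. e / (m + 1))"
        proof (rule integral_norm_bound_integral)
          fix y assume "y \<in> D"
          then have "?q t y \<in> cball 0 M" using qM[OF t] by simp
          then show "norm (?P n (?q t y) - sinc_sqrt lam (?q t y)) \<le> e / (m + 1)"
            using elim by (auto simp: dist_norm intro: less_imp_le)
        qed (use i1 i2 c in \<open>auto intro: integrable_diff\<close>)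
        also have "\<dots> = e / (m + 1) * m" using c by (rule integral_unique)
        also have "\<dots> < e" using e m by (simp add: field_simps)
        finally show "dist (?F n t) (integral D (\<lambda>y. sinc_sqrt lam (?q t y))) < e" .
      qed
    qed
  qed
  then show "\<exists>d>0. cball x d \<subseteq> UNIV \<and> uniform_limit (cball x d) ?F (\<lambda>t. integral D (\<lambda>y. sinc_sqrt lam (?q t y))) sequentially"
    by (intro exI[of _ 1]) auto
qed auto

text \<open>The integrands agree except at the single point y = x. The real kernel inherits
  integrability from the continuous complex one by taking real parts.\<close>

lemma integral_sinc_sqrt_dist:
  fixes D :: "(real^3) set"
  assumes D: "open D" "bounded D"
  shows "integral D (\<lambda>y. sinc_sqrt lam (complex_of_real ((dist y x)\<^sup>2)))
      = complex_of_real (integral D (\<lambda>y. sin (lam * dist y x) / dist y x))"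
proof -
  let ?g = "\<lambda>y. sinc_sqrt lam (complex_of_real ((dist y x)\<^sup>2))"
  let ?f = "\<lambda>y. sin (lam * dist y x) / dist y x"
  define I where "I = integral D ?g"
  have "continuous_on UNIV ?g"
    by (rule continuous_on_compose2[OF continuous_on_sinc_sqrt]) (auto intro!: continuous_intros)
  then have g: "(?g has_integral I) D" unfolding I_def
    by (intro integrable_integral continuous_integrable_on_open_bounded D)
  have eq: "complex_of_real (?f y) = ?g y" if "y \<in> D - {x}" for y
    using that sinc_sqrt_of_real_square[of "dist y x" lam] by simp
  have "((Re \<circ> ?g) has_integral Re I) D" by (rule has_integral_linear[OF g bounded_linear_Re])
  then have f: "(?f has_integral Re I) D"
    by (rule has_integral_spike[of "{x}", rotated -1]) (auto simp del: of_real_divide of_real_power simp flip: eq)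
  have "((complex_of_real \<circ> ?f) has_integral complex_of_real (Re I)) D"
    by (rule has_integral_linear[OF f bounded_linear_of_real])
  then have "(?g has_integral complex_of_real (Re I)) D"
    by (rule has_integral_spike[of "{x}", rotated -1]) (use eq in auto)
  then have "I = complex_of_real (Re I)" using g has_integral_unique by blast
  then show "integral D ?g = complex_of_real (integral D ?f)"
    using f by (simp add: I_def integral_unique)
qed

text \<open>On a line through x0 the squared distance to y is a quadratic polynomial in the line
  parameter t, so both sides of the identity extend to entire functions of t. They agree for large
  real t, where the line is outside D, hence at t = 0.\<close>

lemma sin_kernel_integral_center:
  fixes D :: "(real^3) set" and x0 :: "real^3" and \<kappa> lam :: real
  assumes D: "open D" "bounded D"
    and ident: "\<And>x. x \<notin> D \<Longrightarrow>
      \<kappa> * (sin (lam * dist x x0) / dist x x0) = integral D (\<lambda>y. sin (lam * dist y x) / dist y x)"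
  shows "integral D (\<lambda>y. sin (lam * dist y x0) / dist y x0) = \<kappa> * lam"
proof -
  obtain R where R: "D \<subseteq> ball x0 R" "R > 0"
    using bounded_subset_ballD[OF D(2)] by blast
  define e :: "real^3" where "e = axis 1 1"
  have e: "norm e = 1" "e \<bullet> e = 1" by (auto simp: e_def inner_axis_axis)
  define b where "b y = complex_of_real (e \<bullet> (y - x0))" for y
  define c where "c y = complex_of_real ((norm (y - x0))\<^sup>2)" for y
  have cont: "continuous_on UNIV b" "continuous_on UNIV c"
    unfolding b_def[abs_def] c_def[abs_def] by (intro continuous_intros)+
  \<comment> \<open>The difference of the two sides, with complex line parameter t.\<close>
  define H where "H t = integral D (\<lambda>y. sinc_sqrt lam (t\<^sup>2 - 2 * t * b y + c y)) - \<kappa> * sinc_sqrt lam (t\<^sup>2)" for t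
  have "(\<lambda>t. sinc_sqrt lam (t\<^sup>2)) holomorphic_on UNIV"
    using holomorphic_on_compose_gen[OF _ holomorphic_sinc_sqrt[of lam], of "\<lambda>t. t\<^sup>2" UNIV]
      holomorphic_on_power[OF holomorphic_on_ident[of UNIV], of 2] by (auto simp: o_def)
  then have holo: "H holomorphic_on UNIV" unfolding H_def[abs_def]
    using holomorphic_integral_sinc_sqrt[OF D cont, of lam] by (intro holomorphic_intros) auto
  have line: "(complex_of_real t)\<^sup>2 - 2 * complex_of_real t * b y + c y
      = complex_of_real ((dist y (x0 + t *\<^sub>R e))\<^sup>2)" for t y
  proof -
    have "(dist y (x0 + t *\<^sub>R e))\<^sup>2 = ((y - x0) - t *\<^sub>R e) \<bullet> ((y - x0) - t *\<^sub>R e)"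
      by (simp add: dist_norm power2_norm_eq_inner algebra_simps)
    also have "\<dots> = t\<^sup>2 - 2 * t * (e \<bullet> (y - x0)) + (norm (y - x0))\<^sup>2"
      unfolding power2_norm_eq_inner inner_diff_left[of "y - x0"] inner_diff_right[of _ "y - x0"]
      by (simp add: e inner_commute[of "y - x0" e] power2_eq_square)
    finally show ?thesis by (simp add: b_def c_def)
  qed
  have Hline: "H (complex_of_real t) = complex_of_real
      (integral D (\<lambda>y. sin (lam * dist y (x0 + t *\<^sub>R e)) / dist y (x0 + t *\<^sub>R e)))
      - \<kappa> * sinc_sqrt lam (complex_of_real (t\<^sup>2))" for t
    unfolding H_def line integral_sinc_sqrt_dist[OF D] by simp
  have zero: "H (complex_of_real t) = 0" if "t \<ge> R" for t
  proof -
    have d: "dist (x0 + t *\<^sub>R e) x0 = t" using that R(2) by (simp add: dist_norm e)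
    then have "x0 + t *\<^sub>R e \<notin> D" using R(1) that by (auto simp: dist_commute)
    from ident[OF this] have "integral D (\<lambda>y. sin (lam * dist y (x0 + t *\<^sub>R e)) / dist y (x0 + t *\<^sub>R e)) = \<kappa> * (sin (lam * t) / t)"
      unfolding d by simp
    moreover have "sinc_sqrt lam (complex_of_real (t\<^sup>2)) = complex_of_real (sin (lam * t) / t)"
      using that R(2) by (intro sinc_sqrt_of_real_square) auto
    ultimately show ?thesis unfolding Hline by simp
  qed
  \<comment> \<open>The zeros known so far fill a real ray, and its endpoint R is the accumulation
    point that the identity theorem requires.\<close>
  have lim: "complex_of_real R islimpt complex_of_real ` {R..}"
    unfolding islimpt_approachable
  proof (intro allI impI)
    fix \<epsilon> :: real assume "\<epsilon> > 0"
    then have "R + \<epsilon> / 2 \<in> {R..}" "R + \<epsilon> / 2 \<noteq> R" "\<bar>(R + \<epsilon> / 2) - R\<bar> < \<epsilon>" by auto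
    then show "\<exists>x'\<in>complex_of_real ` {R..}. x' \<noteq> complex_of_real R \<and> dist x' (complex_of_real R) < \<epsilon>"
      by (metis dist_of_real dist_real_def imageI of_real_eq_iff)
  qed
  have "H 0 = 0"
    by (rule analytic_continuation[OF holo _ _ _ _ lim]) (auto simp: zero)
  then have "complex_of_real (integral D (\<lambda>y. sin (lam * dist y x0) / dist y x0)) = complex_of_real (\<kappa> * lam)"
    using Hline[of 0] by (simp add: sinc_sqrt_0)
  then show ?thesis unfolding of_real_eq_iff .
qed

subsection \<open>Identification of the domain\<close>

lemma has_integral_0_nonneg_imp_negligible:
  fixes h :: "'a::euclidean_space \<Rightarrow> real"
  assumes h: "(h has_integral 0) UNIV" and nn: "\<And>y. h y \<ge> 0"
  shows "negligible {y. h y \<noteq> 0}"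
proof -
  have "h absolutely_integrable_on UNIV"
    using h nn by (intro nonnegative_absolutely_integrable_1) auto
  then have i: "integrable lebesgue h" by (simp add: set_integrable_def)
  have "integral\<^sup>L lebesgue h = 0"
    using has_integral_integral_lebesgue[OF i] h has_integral_unique by blast
  then have "AE y in lebesgue. h y = 0"
    using integral_nonneg_eq_0_iff_AE[OF i] nn by auto
  moreover have "{y. h y \<noteq> 0} \<in> sets lebesgue"
    using measurable_sets[OF borel_measurable_integrable[OF i], of "- {0}"] by (simp add: vimage_def)
  ultimately have "{y. h y \<noteq> 0} \<in> null_sets lebesgue"
    by (simp add: AE_iff_null_sets)
  then show ?thesis by (simp add: negligible_iff_null_sets)
qed

text \<open>Equal volumes allow the constant \<open>F r\<close> to be subtracted without disturbing
  the equality of integrals. What remains is positive inside the ball (away from its centre) and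
  negative on D outside it, so the integrand over the ball minus that over D is nonnegative with
  integral 0. Both set differences are therefore null.\<close>

lemma radially_decreasing_rearrangement:
  fixes D :: "'a::euclidean_space set" and F :: "real \<Rightarrow> real"
  assumes D: "open D" "x0 \<in> D" "D \<subseteq> ball x0 r0" and r: "0 < r" "r \<le> r0"
    and dec: "\<And>s t. 0 < s \<Longrightarrow> s < t \<Longrightarrow> t \<le> r0 \<Longrightarrow> F t < F s"
    and meas: "measure lebesgue D = measure lebesgue (ball x0 r)"
    and intD: "((\<lambda>y. F (dist y x0)) has_integral I) D"
    and intB: "((\<lambda>y. F (dist y x0)) has_integral I) (ball x0 r)"
  shows "D \<subseteq> ball x0 r" "negligible (ball x0 r - D)"
proof -
  let ?B = "ball x0 r"
  define m where "m = measure lebesgue D"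
  define g where "g y = F (dist y x0) - F r" for y
  define h where "h y = (if y \<in> ?B then g y else 0) - (if y \<in> D then g y else 0)" for y
  have lm: "D \<in> lmeasurable" "?B \<in> lmeasurable"
    using D bounded_subset[OF bounded_ball D(3)] by (auto intro: lmeasurable_open)
  have const: "((\<lambda>y. F r) has_integral F r * measure lebesgue S) S" if "S \<in> lmeasurable" for S :: "'a set"
    using has_integral_mult_right[OF integrable_integral[OF integrable_on_const[OF that, of "1::real"]], of "F r"]
    by (simp add: lmeasure_integral[OF that])
  have "(g has_integral I - F r * m) D" "(g has_integral I - F r * m) ?B"
    unfolding g_def[abs_def] using has_integral_diff[OF intD const[OF lm(1)]]
      has_integral_diff[OF intB const[OF lm(2)]] meas by (auto simp: m_def)
  moreover have "((\<lambda>y. if y \<in> S then g y else 0) has_integral J) UNIV" if "(g has_integral J) S" for S J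
    using that by (simp only: has_integral_restrict_UNIV)
  ultimately have "(h has_integral (I - F r * m) - (I - F r * m)) UNIV"
    unfolding h_def[abs_def] by (intro has_integral_diff)
  then have h0: "(h has_integral 0) UNIV" by simp
  have out: "g y < 0" if "y \<in> D" "dist x0 y > r" for y
    using that D dec[of r "dist x0 y"] r by (force simp: g_def dist_commute)
  \<comment> \<open>Removing D also removes the centre, because \<open>x0 \<in> D\<close>; nothing
    is assumed about \<open>F 0\<close>.\<close>
  have inn: "g y > 0" if "y \<in> ?B - D" for y
    using that D dec[of "dist x0 y" r] r by (force simp: g_def dist_commute)
  have bd: "g y = 0" if "dist x0 y = r" for y
    using that by (simp add: g_def dist_commute)
  have nn: "h y \<ge> 0" for y
    using out[of y] inn[of y] bd[of y] by (cases "dist x0 y" r rule: linorder_cases) (auto simp: h_def)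
  have neg: "negligible {y. h y \<noteq> 0}" by (rule has_integral_0_nonneg_imp_negligible[OF h0 nn])
  \<comment> \<open>An open null set is empty, so D lies in the closed ball and, being open, in its
    interior. The other difference need not be open and is so far only a null set.\<close>
  have "D - cball x0 r \<subseteq> {y. h y \<noteq> 0}" using out by (fastforce simp: h_def)
  then have "negligible (D - cball x0 r)" using neg negligible_subset by blast
  moreover have "open (D - cball x0 r)" using D by (simp add: open_Diff)
  ultimately have "D \<subseteq> cball x0 r" using open_not_negligible by blast
  then show "D \<subseteq> ?B" using D(1) interior_maximal[of D "cball x0 r"] by simp
  have "?B - D \<subseteq> {y. h y \<noteq> 0}" using inn by (fastforce simp: h_def)
  then show "negligible (?B - D)" using neg negligible_subset by blast
qed

lemma E_plus_eq:
  "E_plus lam y x = complex_of_real (cos (lam * dist y x) / dist y x)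
    + \<i> * complex_of_real (sin (lam * dist y x) / dist y x)"
  unfolding E_plus_def exp_Euler by (simp add: add_divide_distrib flip: cos_of_real sin_of_real)

theorem theorem4:
  fixes lam r r0 :: real and D :: "(real^3) set" and x0 :: "real^3"
  assumes lam_pos: "lam > 0"
    and D_open: "open D" and D_conn: "connected D" and D_bdd: "bounded D"
    and D_ne: "D \<noteq> {}"
    and compl_conn: "connected (- D)"
    and r_pos: "r > 0"
    and vol: "measure lebesgue (ball (0::real^3) r) = measure lebesgue D"
    and r0_pos: "r0 > 0"
    and r0_zero: "bessel_J (3 / 2) (lam * r0) = 0"
    and r0_first: "\<forall>t. 0 < t \<and> t < lam * r0 \<longrightarrow> bessel_J (3 / 2) t \<noteq> 0"
    and x0D: "x0 \<in> D"
    and D_sub: "D \<subseteq> ball x0 r0"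
    and id_plus: "\<forall>x. x \<notin> D \<longrightarrow>
        complex_of_real (a3_minus (lam * r)) * E_plus lam x x0
          = integral D (\<lambda>y. E_plus lam y x) / complex_of_real (measure lebesgue D)"
    and id_minus: "\<forall>x. x \<notin> D \<longrightarrow>
        complex_of_real (a3_minus (lam * r)) * E_minus lam x x0
          = integral D (\<lambda>y. E_minus lam y x) / complex_of_real (measure lebesgue D)"
  shows "D = ball x0 r"
proof -
  define m where "m = measure lebesgue D"
  \<comment> \<open>This is \<open>a3_minus (lam * r)\<close> times the volume of D, so multiplying
    the identities by the volume removes the averages.\<close>
  define \<kappa> where "\<kappa> = 4 * pi / lam ^ 3 * (sin (lam * r) - lam * r * cos (lam * r))"
  have volB: "measure lebesgue (ball c s :: (real^3) set) = 4 / 3 * s ^ 3 * pi" if "s > 0" for c s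
    using sphere_volume[of s c] that by (simp add: measure_completion)
  have m: "m = 4 / 3 * r ^ 3 * pi"
    using vol volB[OF r_pos] by (simp add: m_def)
  have m_pos: "m > 0" unfolding m using r_pos by simp
  have am: "a3_minus (lam * r) * m = \<kappa>"
    using lam_pos r_pos by (simp add: a3_minus_eq m \<kappa>_def field_simps power_mult_distrib)
  have nz: "sin t - t * cos t \<noteq> 0" if "0 < t" "t < lam * r0" for t
    using r0_first that bessel_J_three_halves_eq_0_iff by blast
  \<comment> \<open>Comparison of volumes: the ball of radius r has the volume of D, which lies in
    the ball of radius r0.\<close>
  have r_le: "r \<le> r0"
  proof -
    have "m \<le> measure lebesgue (ball x0 r0)"
      unfolding m_def using D_open D_sub by (intro measure_mono_fmeasurable) auto
    then have "r ^ 3 \<le> r0 ^ 3" using m volB[OF r0_pos] by simp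
    then show ?thesis using power_mono_iff[of r r0 3] r_pos r0_pos by simp
  qed
  \<comment> \<open>As \<kappa> is real, the real and imaginary parts of the \<open>E_plus\<close>
    identity separate.\<close>
  have ids: "integral D (\<lambda>y. cos (lam * dist y x) / dist y x) = \<kappa> * (cos (lam * dist x x0) / dist x x0)"
    "integral D (\<lambda>y. sin (lam * dist y x) / dist y x) = \<kappa> * (sin (lam * dist x x0) / dist x x0)"
    if "x \<notin> D" for x
  proof -
    define C where "C = integral D (\<lambda>y. cos (lam * dist y x) / dist y x)"
    define S where "S = integral D (\<lambda>y. sin (lam * dist y x) / dist y x)"
    have "((\<lambda>y. cos (lam * dist y x) / dist y x) has_integral C) D"
      unfolding C_def by (intro integrable_integral cos_kernel_integrable_on lam_pos D_open D_bdd)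
    from has_integral_linear[OF this bounded_linear_of_real]
    have 1: "((\<lambda>y. complex_of_real (cos (lam * dist y x) / dist y x)) has_integral complex_of_real C) D"
      by (simp only: o_def)
    have "((\<lambda>y. sin (lam * dist y x) / dist y x) has_integral S) D"
      unfolding S_def by (intro integrable_integral sin_kernel_integrable_on lam_pos D_open D_bdd)
    from has_integral_linear[OF this bounded_linear_of_real]
    have "((\<lambda>y. complex_of_real (sin (lam * dist y x) / dist y x)) has_integral complex_of_real S) D"
      by (simp only: o_def)
    from has_integral_add[OF 1 has_integral_mult_right[OF this, of \<i>]]
    have "integral D (\<lambda>y. E_plus lam y x) = complex_of_real C + \<i> * complex_of_real S"
      unfolding E_plus_eq by (rule integral_unique)
    then have "complex_of_real (a3_minus (lam * r)) * E_plus lam x x0 * complex_of_real m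
        = complex_of_real C + \<i> * complex_of_real S"
      using id_plus that m_pos by (simp add: m_def field_simps)
    then have "complex_of_real \<kappa> * E_plus lam x x0 = complex_of_real C + \<i> * complex_of_real S"
      by (simp flip: am add: mult_ac)
    from arg_cong[OF this, of Re] arg_cong[OF this, of Im]
    have "C = \<kappa> * (cos (lam * dist x x0) / dist x x0)" "S = \<kappa> * (sin (lam * dist x x0) / dist x x0)"
      unfolding E_plus_eq by simp_all
    then show "integral D (\<lambda>y. cos (lam * dist y x) / dist y x) = \<kappa> * (cos (lam * dist x x0) / dist x x0)"
      "integral D (\<lambda>y. sin (lam * dist y x) / dist y x) = \<kappa> * (sin (lam * dist x x0) / dist x x0)"
      by (simp_all add: C_def S_def)
  qed
  have "integral D (\<lambda>y. sin (lam * dist y x0) / dist y x0) = \<kappa> * lam"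
    by (rule sin_kernel_integral_center[OF D_open D_bdd]) (simp add: ids(2))
  then have intD: "((\<lambda>y. sin (lam * dist y x0) / dist y x0) has_integral \<kappa> * lam) D"
    using integrable_integral[OF sin_kernel_integrable_on[OF lam_pos D_open D_bdd, of x0]] by simp
  \<comment> \<open>The integral of the sine kernel over the ball has the same value at the centre
    as the continued identity gives for D.\<close>
  have "4 * pi / lam\<^sup>2 * (sin (lam * r) - lam * r * cos (lam * r)) = \<kappa> * lam"
    using lam_pos by (simp add: \<kappa>_def power2_eq_square power3_eq_cube)
  then have intB: "((\<lambda>y. sin (lam * dist y x0) / dist y x0) has_integral \<kappa> * lam) (ball x0 r)"
    using sin_kernel_has_integral_ball[OF lam_pos r_pos, of x0] by simp
  have "measure lebesgue D = measure lebesgue (ball x0 r)"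
    using vol volB[OF r_pos] by simp
  note rearr = radially_decreasing_rearrangement[where F = "\<lambda>t. sin (lam * t) / t",
      OF D_open x0D D_sub r_pos r_le sinc_strict_decreasing[OF lam_pos nz] this intD intB]
  have sub: "D \<subseteq> ball x0 r" and null: "negligible (ball x0 r - D)"
    using rearr by auto
  \<comment> \<open>D and the ball differ by a null set, so integrals over them can be
    exchanged.\<close>
  have has_integral_ball_iff: "(f has_integral v) D \<longleftrightarrow> (f has_integral v) (ball x0 r)"
    for f :: "real^3 \<Rightarrow> real" and v
  proof (rule has_integral_spike_set_eq)
    show "negligible {y \<in> D - ball x0 r. f y \<noteq> 0}"
      using sub by (intro negligible_subset[OF negligible_empty]) blast
    show "negligible {y \<in> ball x0 r - D. f y \<noteq> 0}"
      by (rule negligible_subset[OF null]) blast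
  qed
  have "x \<in> D" if x: "x \<in> ball x0 r" for x
  proof (rule ccontr)
    assume "x \<notin> D"
    define \<rho> where "\<rho> = dist x x0"
    define \<tau> where "\<tau> = lam * (r - \<rho>)"
    have rho: "0 < \<rho>" "\<rho> < r" using x x0D \<open>x \<notin> D\<close> by (auto simp: \<rho>_def dist_commute)
    \<comment> \<open>At a point x of the ball outside D, the cosine integral over the ball equals
      the identity's value minus a positive multiple of this quantity, which must therefore vanish.
      Here \<rho> > 0 because \<open>x0 \<in> D\<close>.\<close>
    let ?defect = "lam * \<rho> - lam * r * cos \<tau> + sin \<tau>"
    have "((\<lambda>y. cos (lam * dist y x) / dist y x) has_integral
        \<kappa> * (cos (lam * \<rho>) / \<rho>) - 4 * pi / (lam ^ 3 * \<rho>) * ?defect) (ball x0 r)"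
      using cos_kernel_has_integral_ball[OF lam_pos, of x x0 r] rho
      by (simp add: \<kappa>_def \<rho>_def \<tau>_def)
    then have "((\<lambda>y. cos (lam * dist y x) / dist y x) has_integral
        \<kappa> * (cos (lam * \<rho>) / \<rho>) - 4 * pi / (lam ^ 3 * \<rho>) * ?defect) D"
      by (simp only: has_integral_ball_iff)
    then have "4 * pi / (lam ^ 3 * \<rho>) * ?defect = 0"
      using ids(1)[OF \<open>x \<notin> D\<close>] by (simp add: \<rho>_def integral_unique)
    then have "?defect = 0" using lam_pos rho by simp
    \<comment> \<open>With lam \<rho> = lam r - \<tau>, the defect splits into a nonnegative term
      and sin \<tau> - \<tau> cos \<tau>. The latter is positive because \<tau> lies below the first
      zero lam r0, which gives the contradiction.\<close>
    moreover have "sin \<tau> - \<tau> * cos \<tau> > 0"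
    proof (rule sin_minus_mult_cos_pos[OF nz])
      show "0 < \<tau>" "\<tau> < lam * r0" using lam_pos rho r_le by (auto simp: \<tau>_def)
    qed
    moreover have "(lam * r - \<tau>) * (1 - cos \<tau>) \<ge> 0"
      using lam_pos rho by (intro mult_nonneg_nonneg) (auto simp: \<tau>_def algebra_simps)
    moreover have "?defect = (lam * r - \<tau>) * (1 - cos \<tau>) + (sin \<tau> - \<tau> * cos \<tau>)"
      by (simp add: \<tau>_def algebra_simps)
    ultimately show False by linarith
  qed
  then show ?thesis using sub by blast
qed

end
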